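(* The $(\phi,\rho)$-similarity measure between Spearman's footrule $\phi$ and Spearman's rho $\rho$ satisfies $$\frac{13}{20}\le \kappa sm(\phi,\rho)\le\frac{121}{64}-\frac{\pi^2}{8}.$$
   Context: Let $\mathbb I=[0,1]$. A bivariate copula is a function $C:\mathbb I^2\to\mathbb I$ with $C(0,v)=C(u,0)=0$, $C(u,1)=u$, $C(1,v)=v$ for all $u,v\in\mathbb I$, and $C(u_2,v_2)-C(u_2,v_1)-C(u_1,v_2)+C(u_1,v_1)\ge 0$ whenever $0\le u_1\le u_2\le 1$, $0\le v_1\le v_2\le 1$. The set of all bivariate copulas is denoted by $\mathcal C$. Let $W\in\mathcal C$ be the lower Fréchet–Hoeffding bound $W(u,v)=\max\{0,u+v-1\}$. Spearman's rho is $\rho(C)=12\int_{\mathbb I^2}C(u,v)\,du\,dv-3$ and Spearman's footrule is $\phi(C)=6\int_0^1C(u,u)\,du-2$. For (weak) concordance measures $\kappa_1,\kappa_2$ (real-valued functions on $\mathcal C$, such as $\phi$ and $\rho$), the $(\kappa_1,\kappa_2)$-similarity measure is $$\kappa sm(\kappa_1,\kappa_2)=1-\frac{A(\kappa_1,\kappa_2)}{(1-\kappa_1(W))(1-\kappa_2(W))},$$ where $A(\kappa_1,\kappa_2)$ is the area (two-dimensional Lebesgue measure) of the exact region $\{(\kappa_1(C),\kappa_2(C)) : C\in\mathcal C\}\subseteq\mathbb R^2$. *)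

theory Defs
  imports "HOL-Analysis.Analysis"
begin

text \<open>Copulas are represented by total functions; only their values on the unit square are
  constrained, and the functionals below only depend on these values.\<close>

definition copula :: "(real \<Rightarrow> real \<Rightarrow> real) \<Rightarrow> bool" where
  "copula C \<longleftrightarrow>
     (\<forall>u\<in>{0..1}. \<forall>v\<in>{0..1}. C u v \<in> {0..1}) \<and>
     (\<forall>v\<in>{0..1}. C 0 v = 0) \<and>
     (\<forall>u\<in>{0..1}. C u 0 = 0) \<and>
     (\<forall>u\<in>{0..1}. C u 1 = u) \<and>
     (\<forall>v\<in>{0..1}. C 1 v = v) \<and>
     (\<forall>u\<^sub>1 u\<^sub>2 v\<^sub>1 v\<^sub>2. 0 \<le> u\<^sub>1 \<and> u\<^sub>1 \<le> u\<^sub>2 \<and> u\<^sub>2 \<le> 1 \<and> 0 \<le> v\<^sub>1 \<and> v\<^sub>1 \<le> v\<^sub>2 \<and> v\<^sub>2 \<le> 1 \<longrightarrow>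
        C u\<^sub>2 v\<^sub>2 - C u\<^sub>2 v\<^sub>1 - C u\<^sub>1 v\<^sub>2 + C u\<^sub>1 v\<^sub>1 \<ge> 0)"

definition frechet_lower :: "real \<Rightarrow> real \<Rightarrow> real" where
  "frechet_lower u v = max 0 (u + v - 1)"

definition spearman_rho :: "(real \<Rightarrow> real \<Rightarrow> real) \<Rightarrow> real" where
  "spearman_rho C = 12 * (LINT p:{0..1} \<times> {0..1}|lborel. C (fst p) (snd p)) - 3"

definition spearman_footrule :: "(real \<Rightarrow> real \<Rightarrow> real) \<Rightarrow> real" where
  "spearman_footrule C = 6 * (LINT u:{0..1}|lborel. C u u) - 2"

definition exact_region ::
  "((real \<Rightarrow> real \<Rightarrow> real) \<Rightarrow> real) \<Rightarrow> ((real \<Rightarrow> real \<Rightarrow> real) \<Rightarrow> real) \<Rightarrow> (real \<times> real) set" where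
  "exact_region \<kappa>\<^sub>1 \<kappa>\<^sub>2 = {(\<kappa>\<^sub>1 C, \<kappa>\<^sub>2 C) | C. copula C}"

definition ksm ::
  "((real \<Rightarrow> real \<Rightarrow> real) \<Rightarrow> real) \<Rightarrow> ((real \<Rightarrow> real \<Rightarrow> real) \<Rightarrow> real) \<Rightarrow> real" where
  "ksm \<kappa>\<^sub>1 \<kappa>\<^sub>2 =
     1 - measure lebesgue (exact_region \<kappa>\<^sub>1 \<kappa>\<^sub>2) /
         ((1 - \<kappa>\<^sub>1 frechet_lower) * (1 - \<kappa>\<^sub>2 frechet_lower))"

end

theory Submission imports Defs begin

text \<open>
  For a pair \<open>(U, V)\<close> with uniform margins and joint distribution function \<open>C\<close> one has
  \<open>\<phi>(C) = 1 - 3 E|U - V|\<close> and \<open>\<rho>(C) = 1 - 6 E(U - V)\<^sup>2\<close>, so the question is which pairs (first moment,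
  second moment) the distance \<open>|U - V|\<close> can have. Both normalising factors come from \<open>W\<close>, where
  \<open>\<phi> = -1/2\<close> and \<open>\<rho> = -1\<close>; hence the similarity measure is \<open>1 - A/3\<close>, and the theorem says
  \<open>3\<pi>\<^sup>2/8 - 171/64 \<le> A \<le> 21/20\<close> for the area \<open>A\<close> of the region.

  Upper bound on the area. The region lies between the graphs of
  \<open>L(x) = -1 + 2 ((1 + 2x)/3)\<^bsup>3/2\<^esup>\<close> and \<open>U(x) = 1 - 2/3 (1 - x)\<^sup>2\<close> over \<open>[-1/2, 1]\<close>
  (\<open>copula_rho_bounds\<close>), and the area between these graphs is exactly \<open>21/20\<close>. The bound by \<open>U\<close> is
  Jensen's inequality \<open>(E|U - V|)\<^sup>2 \<le> E(U - V)\<^sup>2\<close>. The bound by \<open>L\<close> is a transport problem: at a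
  given mean distance the second moment is largest when the mass near both ends is swapped
  antidiagonally and the middle is left on the diagonal. Both bounds are obtained as families of
  affine inequalities between \<open>\<integral>\<integral>C\<close> and \<open>\<integral>C(u,u) du\<close>, from which the curves arise as envelopes; the
  affine inequalities follow from pointwise estimates of \<open>C\<close> by its diagonal and by the Frechet-Hoeffding bounds
  (\<open>rho_lower_linear\<close>, \<open>rho_upper_linear\<close>).

  Lower bound on the area. The region is convex (\<open>convex_region\<close>), so it suffices to exhibit enough of
  its points. A measure-preserving map \<open>T\<close> of the unit interval gives the copula of \<open>(X, T X)\<close> with \<open>X\<close>
  uniform, and the two coefficients are read off from the distribution of \<open>|x - T x|\<close>
  (\<open>map_copula_values\<close>). Three families of involutions are used:
  \<open>end_flip\<close> attains every point of the graph of \<open>L\<close>; \<open>block_swap\<close> moves almost every point by \<open>1/(2n)\<close>, so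
  \<open>|U - V|\<close> is constant and the graph of \<open>U\<close> is attained at \<open>x = 1 - 3/(2n)\<close>; \<open>two_distance_swap\<close>
  uses two distances and yields a curve over \<open>[-1/2, 1/4]\<close> that joins the points for \<open>n = 1\<close> and
  \<open>n = 2\<close>. Below \<open>U\<close>, this curve loses the area \<open>3/160\<close>, and for \<open>n \<ge> 2\<close> the chord from the \<open>n\<close>-th
  point to the next loses \<open>3/8\<close> times \<open>1/(n(n+1))\<^sup>3\<close>. The sum of \<open>1/(n(n+1))\<^sup>3\<close> over \<open>n \<ge> 1\<close> is
  \<open>10 - \<pi>\<^sup>2\<close>, which reduces to \<open>\<Sum> 1/n\<^sup>2 = \<pi>\<^sup>2/6\<close> by partial fractions; its first term is \<open>1/8\<close>.
  Subtracting the losses \<open>3/160 + 3/8 (10 - \<pi>\<^sup>2 - 1/8)\<close> from \<open>21/20\<close> gives the claim.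
\<close>

section \<open>Copulas and their integrals\<close>

lemma copula_mono:
  assumes "copula C" "0 \<le> u" "u \<le> u'" "u' \<le> 1" "0 \<le> v" "v \<le> v'" "v' \<le> 1"
  shows "C u v \<le> C u' v'"
proof -
  have inc: "C u\<^sub>2 v\<^sub>2 - C u\<^sub>2 v\<^sub>1 - C u\<^sub>1 v\<^sub>2 + C u\<^sub>1 v\<^sub>1 \<ge> 0"
    if "0 \<le> u\<^sub>1" "u\<^sub>1 \<le> u\<^sub>2" "u\<^sub>2 \<le> 1" "0 \<le> v\<^sub>1" "v\<^sub>1 \<le> v\<^sub>2" "v\<^sub>2 \<le> 1" for u\<^sub>1 u\<^sub>2 v\<^sub>1 v\<^sub>2
    using assms(1) that unfolding copula_def by blast
  have z: "C 0 w = 0" "C w 0 = 0" if "0 \<le> w" "w \<le> 1" for w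
    using assms(1) that unfolding copula_def by auto
  have "C u v \<le> C u' v"
    using inc[of u u' 0 v] z assms by auto
  moreover have "C u' v \<le> C u' v'"
    using inc[of 0 u' v v'] z assms by auto
  ultimately show ?thesis by linarith
qed

text \<open>The increment of \<open>C\<close> in one variable is largest when the other variable equals 1, where \<open>C\<close>
  has slope one.\<close>

lemma copula_lipschitz:
  assumes "copula C" "0 \<le> u" "u \<le> u'" "u' \<le> 1" "0 \<le> v" "v \<le> v'" "v' \<le> 1"
  shows "C u' v' \<le> C u v + (u' - u) + (v' - v)"
proof -
  have inc: "C u\<^sub>2 v\<^sub>2 - C u\<^sub>2 v\<^sub>1 - C u\<^sub>1 v\<^sub>2 + C u\<^sub>1 v\<^sub>1 \<ge> 0"
    if "0 \<le> u\<^sub>1" "u\<^sub>1 \<le> u\<^sub>2" "u\<^sub>2 \<le> 1" "0 \<le> v\<^sub>1" "v\<^sub>1 \<le> v\<^sub>2" "v\<^sub>2 \<le> 1" for u\<^sub>1 u\<^sub>2 v\<^sub>1 v\<^sub>2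
    using assms(1) that unfolding copula_def by blast
  have o: "C 1 w = w" "C w 1 = w" if "0 \<le> w" "w \<le> 1" for w
    using assms(1) that unfolding copula_def by auto
  have "C u' v \<le> C u v + (u' - u)"
    using inc[of u u' v 1] o[of u] o[of u'] assms by auto
  moreover have "C u' v' \<le> C u' v + (v' - v)"
    using inc[of u' 1 v v'] o[of v] o[of v'] assms by auto
  ultimately show ?thesis by linarith
qed

lemma copula_bounds:
  assumes "copula C" "0 \<le> u" "u \<le> 1" "0 \<le> v" "v \<le> 1"
  shows "0 \<le> C u v" "C u v \<le> 1" "C u v \<le> u" "C u v \<le> v" "u + v - 1 \<le> C u v"
proof -
  have o: "C 1 w = w" "C w 1 = w" if "0 \<le> w" "w \<le> 1" for w
    using assms(1) that unfolding copula_def by auto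
  show "0 \<le> C u v" "C u v \<le> 1" using assms unfolding copula_def by auto
  show "C u v \<le> u" using copula_mono[of C u u v 1] o assms by auto
  show "C u v \<le> v" using copula_mono[of C u 1 v v] o assms by auto
  show "u + v - 1 \<le> C u v" using copula_lipschitz[of C u 1 v v] o assms by auto
qed

text \<open>Continuity makes every integral below a Riemann integral, so that iterated integration and
  the fundamental theorem of calculus apply.\<close>

lemma copula_continuous:
  assumes "copula C"
  shows "continuous_on ({0..1} \<times> {0..1}) (\<lambda>p. C (fst p) (snd p))"
proof -
  have aux: "\<bar>C a b - C c d\<bar> \<le> \<bar>a - c\<bar> + \<bar>b - d\<bar>"
    if r: "a \<in> {0..1}" "b \<in> {0..1}" "c \<in> {0..1}" "d \<in> {0..1}" for a b c d
  proof -
    have "C (max a c) (max b d) \<le> C (min a c) (min b d) + (max a c - min a c) + (max b d - min b d)"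
      by (rule copula_lipschitz) (use assms r in auto)
    moreover have "C a b \<le> C (max a c) (max b d)" "C c d \<le> C (max a c) (max b d)"
      "C (min a c) (min b d) \<le> C a b" "C (min a c) (min b d) \<le> C c d"
      by (rule copula_mono; use assms r in auto)+
    moreover have "(max a c - min a c) = \<bar>a - c\<bar>" "(max b d - min b d) = \<bar>b - d\<bar>" by auto
    ultimately show ?thesis by linarith
  qed
  have "2-lipschitz_on ({0..1} \<times> {0..1}) (\<lambda>p. C (fst p) (snd p))"
  proof (rule lipschitz_onI)
    fix p q :: "real \<times> real" assume pq: "p \<in> {0..1} \<times> {0..1}" "q \<in> {0..1} \<times> {0..1}"
    have "dist (C (fst p) (snd p)) (C (fst q) (snd q)) \<le> dist (fst p) (fst q) + dist (snd p) (snd q)"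
      using aux[of "fst p" "snd p" "fst q" "snd q"] pq by (auto simp: dist_real_def)
    also have "\<dots> \<le> 2 * dist p q" using dist_fst_le[of p q] dist_snd_le[of p q] by linarith
    finally show "dist (C (fst p) (snd p)) (C (fst q) (snd q)) \<le> 2 * dist p q" .
  qed simp
  thus ?thesis by (rule lipschitz_on_continuous_on)
qed

lemma copula_continuous_comp:
  assumes "copula C" "continuous_on S f" "continuous_on S g"
    "\<And>x. x \<in> S \<Longrightarrow> f x \<in> {0..1}" "\<And>x. x \<in> S \<Longrightarrow> g x \<in> {0..1}"
  shows "continuous_on S (\<lambda>x. C (f x) (g x))"
proof -
  have "continuous_on S (\<lambda>x. (\<lambda>p. C (fst p) (snd p)) (f x, g x))"
    by (rule continuous_on_compose2[OF copula_continuous[OF assms(1)]])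
      (use assms in \<open>auto intro!: continuous_intros\<close>)
  thus ?thesis by simp
qed

lemma footrule_eq:
  assumes "copula C"
  shows "spearman_footrule C = 6 * integral {0..1} (\<lambda>u. C u u) - 2"
proof -
  have "continuous_on {0..1} (\<lambda>u. C u u)"
    by (rule copula_continuous_comp[OF assms]) (auto intro: continuous_intros)
  hence "set_integrable lborel {0..1} (\<lambda>u. C u u)"
    by (rule borel_integrable_atLeastAtMost')
  thus ?thesis unfolding spearman_footrule_def by (simp add: set_borel_integral_eq_integral)
qed

lemma copula_set_integrable:
  assumes "copula C"
  shows "set_integrable lborel ({0..1} \<times> {0..1}) (\<lambda>p. C (fst p) (snd p))"
  unfolding set_integrable_def
  by (rule borel_integrable_compact) (auto intro: compact_Times copula_continuous assms)

lemma rho_eq: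
  assumes "copula C"
  shows "spearman_rho C = 12 * integral {0..1} (\<lambda>v. integral {0..1} (\<lambda>u. C u v)) - 3"
proof -
  have eq: "{0..1} \<times> {0..1} = cbox (0::real,0::real) (1,1)" by (auto simp: cbox_Pair_eq)
  have c: "continuous_on (cbox (0::real,0::real) (1,1)) (\<lambda>p. C (fst p) (snd p))"
    using copula_continuous[OF assms] eq by simp
  have "(LINT p:{0..1} \<times> {0..1}|lborel. C (fst p) (snd p)) =
     integral (cbox (0,0) (1,1)) (\<lambda>p. C (fst p) (snd p))"
    using set_borel_integral_eq_integral(2)[OF copula_set_integrable[OF assms]] eq by simp
  also have "\<dots> = integral (cbox 0 1) (\<lambda>u. integral (cbox 0 1) (\<lambda>v. C u v))"
    using integral_prod_continuous[OF c] by simp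
  also have "\<dots> = integral (cbox 0 1) (\<lambda>v. integral (cbox 0 1) (\<lambda>u. C u v))"
    by (rule integral_swap_continuous) (use c in \<open>simp add: case_prod_beta\<close>)
  finally show ?thesis unfolding spearman_rho_def by simp
qed

section \<open>Affine bounds between the two coefficients\<close>

text \<open>Supporting lines of the lower boundary, one for each slope parameter \<open>r\<close>. The extremal
  copula is the antidiagonal swap of the two ends \<open>[0, e)\<close> and \<open>(1 - e, 1]\<close> with \<open>1 - 2e = r\<close>. For
  \<open>v\<close> in \<open>[e, 1 - e]\<close> monotonicity (if \<open>u \<le> v\<close>) and the Lipschitz property (if \<open>u > v\<close>) bound
  \<open>C(u,v)\<close> below by \<open>C(u,u) - max 0 (u - v)\<close>; for the other \<open>v\<close> the bound \<open>C \<ge> W\<close> is used. Each of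
  these estimates is an equality for the extremal copula, and integrating over \<open>u\<close> produces the
  diagonal integral with total weight \<open>r\<close>.\<close>

lemma rho_lower_linear:
  assumes "copula C" and r: "0 \<le> r" "r \<le> 1"
  shows "integral {0..1} (\<lambda>v. integral {0..1} (\<lambda>u. C u v))
     \<ge> r * integral {0..1} (\<lambda>u. C u u) + 1/6 - r/4 - r^3/12"
proof -
  define e where "e = (1 - r) / 2"
  have e: "0 \<le> e" "e \<le> 1 - e" "1 - e \<le> 1" using r by (auto simp: e_def field_simps)
  define d where "d = integral {0..1} (\<lambda>u. C u u)"
  define J where "J = (\<lambda>v. integral {0..1} (\<lambda>u. C u v))"
  have contu: "continuous_on {0..1} (\<lambda>u. C u v)" if "v \<in> {0..1}" for v
    by (rule copula_continuous_comp[OF assms(1)]) (use that in \<open>auto intro: continuous_intros\<close>)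
  have contJ: "continuous_on {0..1} J"
  proof -
    have "continuous_on (cbox 0 1) (\<lambda>v. integral (cbox 0 1) (\<lambda>u. C u v))"
      by (rule integral_continuous_on_param)
        (unfold case_prod_beta, rule copula_continuous_comp[OF assms(1)], auto intro!: continuous_intros)
    thus ?thesis by (simp add: J_def)
  qed
  have contd: "continuous_on {0..1} (\<lambda>u. C u u)"
    by (rule copula_continuous_comp[OF assms(1)]) (auto intro: continuous_intros)
  \<comment> \<open>Read with \<open>1 - v\<close> in place of \<open>v\<close>, this also integrates \<open>max 0 (u - v)\<close>.\<close>
  have hasW: "((\<lambda>u. max 0 (u + v - 1)) has_integral v^2/2) {0..1}" if v: "v \<in> {0..1}" for v :: real
  proof -
    have "((\<lambda>u. max 0 (u + v - 1)) has_integral 0) {0..1-v}"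
      by (rule has_integral_is_0) (use v in auto)
    moreover have "((\<lambda>u. u + v - 1) has_integral ((1+v-1)^2/2 - ((1-v)+v-1)^2/2)) {1-v..1}"
      by (rule fundamental_theorem_of_calculus)
        (use v in \<open>auto intro!: derivative_eq_intros simp: has_real_derivative_iff_has_vector_derivative[symmetric]\<close>)
    hence "((\<lambda>u. max 0 (u + v - 1)) has_integral v^2/2) {1-v..1}"
      by (rule has_integral_eq_rhs[OF has_integral_eq, rotated]) auto
    ultimately show ?thesis
      using has_integral_combine[of 0 "1-v" 1 "\<lambda>u. max 0 (u + v - 1)" 0 "v^2/2"] v by auto
  qed
  have J1: "J v \<ge> v^2/2" if v: "v \<in> {0..1}" for v
  proof -
    have "integral {0..1} (\<lambda>u. max 0 (u + v - 1)) \<le> J v" unfolding J_def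
      by (rule integral_le)
        (use hasW[OF v] integrable_continuous_interval[OF contu[OF v]] copula_bounds[OF assms(1)] v in auto)
    thus ?thesis using hasW[OF v] by (simp add: integral_unique)
  qed
  have J2: "J v \<ge> d - (1-v)^2/2" if v: "v \<in> {0..1}" for v
  proof -
    have h: "((\<lambda>u. max 0 (u - v)) has_integral (1-v)^2/2) {0..1}"
      using hasW[of "1-v"] v by (simp add: algebra_simps)
    have h2: "((\<lambda>u. C u u - max 0 (u - v)) has_integral (d - (1-v)^2/2)) {0..1}"
      unfolding d_def by (intro has_integral_diff h integrable_integral integrable_continuous_interval contd)
    have "integral {0..1} (\<lambda>u. C u u - max 0 (u - v)) \<le> J v" unfolding J_def
    proof (rule integral_le)
      fix u :: real assume u: "u \<in> {0..1}"
      show "C u u - max 0 (u - v) \<le> C u v"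
      proof (cases "u \<le> v")
        case True
        thus ?thesis using copula_mono[OF assms(1), of u u u v] u v by auto
      next
        case False
        thus ?thesis using copula_lipschitz[OF assms(1), of u u v u] u v by auto
      qed
    qed (use h2 integrable_continuous_interval[OF contu[OF v]] in auto)
    thus ?thesis using h2 by (simp add: integral_unique)
  qed
  have iJ: "J integrable_on {a..b}" if "0 \<le> a" "b \<le> 1" for a b
    by (rule integrable_continuous_interval, rule continuous_on_subset[OF contJ]) (use that in auto)
  have p1: "((\<lambda>v. v^2/2) has_integral (b^3/6 - a^3/6)) {a..b}" if "a \<le> b" for a b :: real
    by (rule fundamental_theorem_of_calculus)
      (use that in \<open>auto intro!: derivative_eq_intros simp: has_real_derivative_iff_has_vector_derivative[symmetric]\<close>)
  have p2: "((\<lambda>v. d - (1-v)^2/2) has_integral ((d*b + (1-b)^3/6) - (d*a + (1-a)^3/6))) {a..b}" if "a \<le> b" for a b :: real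
    by (rule fundamental_theorem_of_calculus)
      (use that in \<open>auto intro!: derivative_eq_intros simp: has_real_derivative_iff_has_vector_derivative[symmetric] power2_eq_square\<close>)
  have "integral {0..e} J \<ge> e^3/6 - 0^3/6"
    by (rule has_integral_le[OF p1 integrable_integral[OF iJ]]) (use e J1 in auto)
  moreover have "integral {e..1-e} J \<ge> (d*(1-e) + (1-(1-e))^3/6) - (d*e + (1-e)^3/6)"
    by (rule has_integral_le[OF p2 integrable_integral[OF iJ]]) (use e J2 in auto)
  moreover have "integral {1-e..1} J \<ge> 1^3/6 - (1-e)^3/6"
    by (rule has_integral_le[OF p1 integrable_integral[OF iJ]]) (use e J1 in auto)
  moreover have "integral {0..1} J = integral {0..e} J + integral {e..1-e} J + integral {1-e..1} J"
  proof -
    have "integral {0..e} J + integral {e..1} J = integral {0..1} J"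
      by (rule Henstock_Kurzweil_Integration.integral_combine) (use e iJ in auto)
    moreover have "integral {e..1-e} J + integral {1-e..1} J = integral {e..1} J"
      by (rule Henstock_Kurzweil_Integration.integral_combine) (use e iJ in auto)
    ultimately show ?thesis by simp
  qed
  ultimately have "integral {0..1} J \<ge> d * (1 - 2*e) + 1/6 + e^3/3 - (1-e)^3/3"
    by (simp add: algebra_simps)
  also have "d * (1 - 2*e) + 1/6 + e^3/3 - (1-e)^3/3 = r * d + 1/6 - r/4 - r^3/12"
    unfolding e_def by (simp add: field_simps power3_eq_cube)
  finally show ?thesis by (simp add: J_def d_def)
qed

lemma nn_integral_continuous_interval:
  fixes g :: "real \<Rightarrow> real"
  assumes "continuous_on {a..b} g" "\<And>x. x \<in> {a..b} \<Longrightarrow> 0 \<le> g x"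
  shows "(\<integral>\<^sup>+x. ennreal (g x) * indicator {a..b} x \<partial>lborel) = ennreal (integral {a..b} g)"
proof -
  have si: "set_integrable lborel {a..b} g" by (rule borel_integrable_atLeastAtMost'[OF assms(1)])
  have "(\<integral>\<^sup>+x. ennreal (g x) * indicator {a..b} x \<partial>lborel) =
      (\<integral>\<^sup>+x. ennreal (indicator {a..b} x *\<^sub>R g x) \<partial>lborel)"
    by (intro nn_integral_cong) (auto split: split_indicator)
  also have "\<dots> = ennreal (LINT x:{a..b}|lborel. g x)"
    unfolding set_lebesgue_integral_def
    by (rule nn_integral_eq_integral)
      (use si assms in \<open>auto simp: set_integrable_def split: split_indicator\<close>)
  finally show ?thesis by (simp add: set_borel_integral_eq_integral(2)[OF si])
qed

text \<open>Integration over the plane along the lines \<open>v - u = w\<close>, with the lines for \<open>w\<close> and \<open>-w\<close>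
  grouped together. Counting the diagonal twice does no harm for an upper bound.\<close>

lemma nn_integral_by_difference:
  fixes f :: "real \<times> real \<Rightarrow> ennreal"
  assumes [measurable]: "f \<in> borel_measurable (lborel \<Otimes>\<^sub>M lborel)"
  shows "(\<integral>\<^sup>+p. f p \<partial>(lborel \<Otimes>\<^sub>M lborel)) \<le>
    (\<integral>\<^sup>+w. (\<integral>\<^sup>+u. f (u, u + w) + f (u + w, u) \<partial>lborel) * indicator {0..} w \<partial>lborel)"
proof -
  have m: "f \<in> borel_measurable (borel \<Otimes>\<^sub>M borel)" using assms by simp
  note [measurable] = m
  define k where "k w = (\<integral>\<^sup>+u. f (u, u + w) \<partial>lborel)" for w
  have k[measurable]: "k \<in> borel_measurable borel" unfolding k_def by measurable
  have "(\<integral>\<^sup>+p. f p \<partial>(lborel \<Otimes>\<^sub>M lborel)) = (\<integral>\<^sup>+u. \<integral>\<^sup>+v. f (u, v) \<partial>lborel \<partial>lborel)"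
    by (rule lborel.nn_integral_fst[symmetric]) measurable
  also have "\<dots> = (\<integral>\<^sup>+u. \<integral>\<^sup>+w. f (u, u + w) \<partial>lborel \<partial>lborel)"
  proof (rule nn_integral_cong)
    fix u :: real
    show "(\<integral>\<^sup>+v. f (u, v) \<partial>lborel) = (\<integral>\<^sup>+w. f (u, u + w) \<partial>lborel)"
      by (subst nn_integral_real_affine[where c=1 and t=u]) auto
  qed
  also have "\<dots> = (\<integral>\<^sup>+w. k w \<partial>lborel)"
    unfolding k_def by (rule lborel_pair.Fubini'[symmetric]) measurable
  also have "\<dots> = (\<integral>\<^sup>+w. k w * indicator {0..} w + k w * indicator {..<0} w \<partial>lborel)"
    by (intro nn_integral_cong) (auto split: split_indicator)
  also have "\<dots> = (\<integral>\<^sup>+w. k w * indicator {0..} w \<partial>lborel) + (\<integral>\<^sup>+w. k w * indicator {..<0} w \<partial>lborel)"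
    by (rule nn_integral_add) measurable
  also have "(\<integral>\<^sup>+w. k w * indicator {..<0} w \<partial>lborel) = (\<integral>\<^sup>+w. k (- w) * indicator {..<0} (- w) \<partial>lborel)"
    by (subst nn_integral_real_affine[where c="-1" and t=0]) auto
  also have "\<dots> \<le> (\<integral>\<^sup>+w. k (- w) * indicator {0..} w \<partial>lborel)"
    by (intro nn_integral_mono) (auto split: split_indicator)
  also have "(\<integral>\<^sup>+w. k w * indicator {0..} w \<partial>lborel) + (\<integral>\<^sup>+w. k (- w) * indicator {0..} w \<partial>lborel)
     = (\<integral>\<^sup>+w. (k w + k (- w)) * indicator {0..} w \<partial>lborel)"
    by (subst nn_integral_add[symmetric]) (auto simp: algebra_simps)
  also have "\<dots> = (\<integral>\<^sup>+w. (\<integral>\<^sup>+u. f (u, u + w) + f (u + w, u) \<partial>lborel) * indicator {0..} w \<partial>lborel)"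
  proof (intro nn_integral_cong arg_cong2[where f="(*)"] refl)
    fix w :: real
    have "k (- w) = (\<integral>\<^sup>+u. f (u + w, u) \<partial>lborel)" unfolding k_def
      by (subst nn_integral_real_affine[where c=1 and t=w]) (auto simp: add.commute)
    thus "k w + k (- w) = (\<integral>\<^sup>+u. f (u, u + w) + f (u + w, u) \<partial>lborel)"
      unfolding k_def by (subst nn_integral_add) auto
  qed
  finally show ?thesis by simp
qed

text \<open>Two bounds for the integral of \<open>C\<close> along the pair of lines at distance \<open>w\<close> from the
  diagonal. The first is 2-increasingness on the squares \<open>[u, u + w]\<^sup>2\<close>, sharp if they carry no
  mass; the second is \<open>C(u,v) \<le> min u v\<close>, sharp if no mass lies farther than \<open>w\<close> from the
  diagonal. A copula with constant \<open>|U - V| = c\<close> satisfies the former for \<open>w \<le> c\<close> and the latter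
  for \<open>w > c\<close>.\<close>

lemma copula_diagonal_shift_bound:
  assumes "copula C" and w: "0 \<le> w" "w \<le> 1"
  shows "integral {0..1-w} (\<lambda>u. C u (u + w) + C (u + w) u)
     \<le> 2 * integral {0..1} (\<lambda>u. C u u) - (w - w^2)" (is ?A)
    and "integral {0..1-w} (\<lambda>u. C u (u + w) + C (u + w) u) \<le> (1 - w)^2" (is ?B)
    and "continuous_on {0..1-w} (\<lambda>u. C u (u + w) + C (u + w) u)"
proof -
  note cc = copula_continuous_comp[OF assms(1)]
  have [intro!]: "continuous_on {0..1-w} (\<lambda>u. C u (u + w))" "continuous_on {0..1-w} (\<lambda>u. C (u + w) u)"
    by (rule cc; use w in \<open>auto intro!: continuous_intros\<close>)+
  show cS: "continuous_on {0..1-w} (\<lambda>u. C u (u + w) + C (u + w) u)"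
    by (intro continuous_intros) auto
  define \<delta> where "\<delta> u = C u u" for u
  have c\<delta>: "continuous_on {0..1} \<delta>"
    unfolding \<delta>_def by (rule cc) (auto intro!: continuous_intros)
  have i\<delta>: "\<delta> integrable_on {a..b}" if "0 \<le> a" "b \<le> 1" for a b
    by (rule integrable_continuous_interval, rule continuous_on_subset[OF c\<delta>]) (use that in auto)
  have sh: "((\<lambda>u. \<delta> (u + w)) has_integral integral {w..1} \<delta>) {0..1-w}"
  proof -
    have "((\<lambda>u. \<delta> (1 *\<^sub>R u + w)) has_integral (1 / \<bar>1\<bar> ^ DIM(real)) *\<^sub>R integral {w..1} \<delta>)
       ((\<lambda>x. (1 / 1) *\<^sub>R x + -((1 / 1) *\<^sub>R w)) ` cbox w 1)"
      by (rule has_integral_affinity) (use w i\<delta>[of w 1] in \<open>auto intro: integrable_integral\<close>)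
    moreover have "(\<lambda>x. (1 / 1) *\<^sub>R x + -((1 / 1) *\<^sub>R w)) ` cbox w 1 = {0..1-w}"
      using w by (simp add: image_add_atLeastAtMost)
    ultimately show ?thesis by simp
  qed
  have "integral {0..1-w} (\<lambda>u. C u (u + w) + C (u + w) u) \<le> integral {0..1-w} (\<lambda>u. \<delta> u + \<delta> (u + w))"
  proof (rule integral_le)
    fix u assume u: "u \<in> {0..1-w}"
    have "C (u+w) (u+w) - C (u+w) u - C u (u+w) + C u u \<ge> 0"
      using assms(1) u w unfolding copula_def by auto
    thus "C u (u + w) + C (u + w) u \<le> \<delta> u + \<delta> (u + w)" unfolding \<delta>_def by linarith
  qed (use sh i\<delta>[of 0 "1-w"] w in \<open>auto intro!: integrable_continuous_interval[OF cS] integrable_add\<close>)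
  also have "\<dots> = integral {0..1-w} \<delta> + integral {w..1} \<delta>"
    by (subst Henstock_Kurzweil_Integration.integral_add)
      (use sh i\<delta>[of 0 "1-w"] w in \<open>auto simp: integral_unique\<close>)
  also have "integral {0..1-w} \<delta> = integral {0..1} \<delta> - integral {1-w..1} \<delta>"
    using Henstock_Kurzweil_Integration.integral_combine[of 0 "1-w" 1 \<delta>] w i\<delta>[of 0 1] by auto
  also have "integral {w..1} \<delta> = integral {0..1} \<delta> - integral {0..w} \<delta>"
    using Henstock_Kurzweil_Integration.integral_combine[of 0 w 1 \<delta>] w i\<delta>[of 0 1] by auto
  finally have main: "integral {0..1-w} (\<lambda>u. C u (u + w) + C (u + w) u) \<le>
    integral {0..1} \<delta> - integral {1-w..1} \<delta> + (integral {0..1} \<delta> - integral {0..w} \<delta>)" .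
  have "integral {0..w} \<delta> \<ge> 0"
    by (rule integral_nonneg) (use i\<delta>[of 0 w] w copula_bounds[OF assms(1)] in \<open>auto simp: \<delta>_def\<close>)
  moreover have "integral {1-w..1} \<delta> \<ge> w - w^2"
  proof -
    have "((\<lambda>u. 2*u-1) has_integral ((1^2 - 1) - ((1-w)^2 - (1-w)))) {1-w..1}"
      by (rule fundamental_theorem_of_calculus)
        (use w in \<open>auto intro!: derivative_eq_intros simp: has_real_derivative_iff_has_vector_derivative[symmetric]\<close>)
    hence "(1^2 - 1) - ((1-w)^2 - (1-w)) \<le> integral {1-w..1} \<delta>"
    proof (rule has_integral_le[OF _ integrable_integral[OF i\<delta>]])
      fix u assume "u \<in> {1-w..1}"
      thus "2*u-1 \<le> \<delta> u" using copula_bounds(5)[OF assms(1), of u u] w by (auto simp: \<delta>_def)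
    qed (use w in auto)
    thus ?thesis by (simp add: power2_eq_square algebra_simps)
  qed
  ultimately show ?A using main unfolding \<delta>_def by linarith
  have "((\<lambda>u. 2*u) has_integral ((1-w)^2 - 0^2)) {0..1-w}"
    by (rule fundamental_theorem_of_calculus)
      (use w in \<open>auto intro!: derivative_eq_intros simp: has_real_derivative_iff_has_vector_derivative[symmetric]\<close>)
  hence "integral {0..1-w} (\<lambda>u. C u (u + w) + C (u + w) u) \<le> (1-w)^2 - 0^2"
  proof (rule has_integral_le[OF integrable_integral[OF integrable_continuous_interval[OF cS]]])
    fix u assume u: "u \<in> {0..1-w}"
    show "C u (u + w) + C (u + w) u \<le> 2 * u"
      using copula_bounds(3)[OF assms(1), of u "u+w"] copula_bounds(4)[OF assms(1), of "u+w" u] u w by auto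
  qed
  thus ?B by simp
qed

text \<open>This is \<open>E(|U - V| - c)\<^sup>2 \<ge> 0\<close>, expressed without the measure induced by \<open>C\<close>: the line
  integrals at distance \<open>w\<close> from the diagonal are bounded by the first estimate of the preceding
  lemma for \<open>w \<le> c\<close> and by the second for \<open>w > c\<close>.\<close>

lemma rho_upper_linear:
  assumes "copula C" and c: "0 \<le> c" "c \<le> 1"
  shows "(LINT p:{0..1}\<times>{0..1}|lborel. C (fst p) (snd p))
     \<le> 1/3 - c + 2 * c * integral {0..1} (\<lambda>u. C u u) + c^2/2"
proof -
  define d where "d = integral {0..1} (\<lambda>u. C u u)"
  define f where "f p = indicator ({0..1}\<times>{0..1}) p *\<^sub>R C (fst p) (snd p)" for p :: "real \<times> real"
  have f_int: "integrable lborel f"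
    using copula_set_integrable[OF assms(1)] unfolding set_integrable_def f_def by simp
  hence fm: "f \<in> borel_measurable borel" by auto
  have f0: "0 \<le> f p" for p
    unfolding f_def using copula_bounds[OF assms(1)] by (auto split: split_indicator)
  \<comment> \<open>The bound for the lines at distance \<open>w\<close> that is sharp for constant \<open>|U - V| = c\<close>.\<close>
  define B where "B w = (if w \<le> c then 2*d - (w - w^2) else (1-w)^2)" for w
  have bound: "(\<integral>\<^sup>+u. ennreal (f (u, u + w)) + ennreal (f (u + w, u)) \<partial>lborel) \<le> ennreal (B w) * indicator {0..1} w"
    if w: "0 \<le> w" for w
  proof (cases "w \<le> 1")
    case True
    let ?S = "\<lambda>u. C u (u + w) + C (u + w) u"
    have "(\<integral>\<^sup>+u. ennreal (f (u, u + w)) + ennreal (f (u + w, u)) \<partial>lborel)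
      = (\<integral>\<^sup>+u. ennreal (?S u) * indicator {0..1-w} u \<partial>lborel)"
      by (intro nn_integral_cong)
        (use w copula_bounds[OF assms(1)] in \<open>auto simp: f_def ennreal_plus[symmetric] simp del: ennreal_plus split: split_indicator\<close>)
    also have "\<dots> = ennreal (integral {0..1-w} ?S)"
      by (rule nn_integral_continuous_interval[OF copula_diagonal_shift_bound(3)[OF assms(1) w True]])
        (use w copula_bounds[OF assms(1)] in auto)
    also have "\<dots> \<le> ennreal (B w)"
      using copula_diagonal_shift_bound(1,2)[OF assms(1) w True] by (auto simp: B_def d_def intro!: ennreal_leI)
    finally show ?thesis using w True by simp
  next
    case False
    have "(\<integral>\<^sup>+u. ennreal (f (u, u + w)) + ennreal (f (u + w, u)) \<partial>lborel) = (\<integral>\<^sup>+u. 0 \<partial>(lborel :: real measure))"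
      by (intro nn_integral_cong) (use False w in \<open>auto simp: f_def split: split_indicator\<close>)
    thus ?thesis by simp
  qed
  have p1: "((\<lambda>w. 2*d - (w - w^2)) has_integral ((2*d*b - b^2/2 + b^3/3) - (2*d*a - a^2/2 + a^3/3))) {a..b}" if "a \<le> b" for a b :: real
    by (rule fundamental_theorem_of_calculus)
      (use that in \<open>auto intro!: derivative_eq_intros simp: has_real_derivative_iff_has_vector_derivative[symmetric] power2_eq_square\<close>)
  have p2: "((\<lambda>w. (1-w)^2) has_integral (- ((1-b)^3/3) - - ((1-a)^3/3))) {a..b}" if "a \<le> b" for a b :: real
    by (rule fundamental_theorem_of_calculus)
      (use that in \<open>auto intro!: derivative_eq_intros simp: has_real_derivative_iff_has_vector_derivative[symmetric] power2_eq_square\<close>)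
  have "(B has_integral (((2*d*c - c^2/2 + c^3/3) - (2*d*0 - 0^2/2 + 0^3/3)) + (- ((1-1)^3/3) - - ((1-c)^3/3)))) {0..1}"
  proof (rule has_integral_combine)
    show "(B has_integral ((2*d*c - c^2/2 + c^3/3) - (2*d*0 - 0^2/2 + 0^3/3))) {0..c}"
      by (rule has_integral_eq[OF _ p1]) (use c in \<open>auto simp: B_def\<close>)
    show "(B has_integral (- ((1-1)^3/3) - - ((1-c)^3/3))) {c..1}"
      by (rule has_integral_spike_finite[OF _ _ p2, of "{c}"]) (use c in \<open>auto simp: B_def\<close>)
  qed (use c in auto)
  also have "((2*d*c - c^2/2 + c^3/3) - (2*d*0 - 0^2/2 + 0^3/3)) + (- ((1-1)^3/3) - - ((1-c)^3/3))
     = 1/3 - c + 2 * c * d + c^2/2"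
    by (simp add: field_simps power2_eq_square power3_eq_cube)
  finally have B: "(B has_integral (1/3 - c + 2 * c * d + c^2/2)) {0..1}" .
  have B0: "0 \<le> B w" if w: "w \<in> {0..1}" for w
  proof -
    have "0 \<le> integral {0..1-w} (\<lambda>u. C u (u + w) + C (u + w) u)"
      by (rule integral_nonneg)
        (use w copula_bounds[OF assms(1)] copula_diagonal_shift_bound(3)[OF assms(1), of w] in
          \<open>auto intro!: integrable_continuous_interval add_nonneg_nonneg\<close>)
    thus ?thesis using copula_diagonal_shift_bound(1)[OF assms(1), of w] w by (auto simp: B_def d_def)
  qed
  have Bm[measurable]: "B \<in> borel_measurable borel" unfolding B_def by measurable
  have "ennreal (\<integral>p. f p \<partial>lborel) = (\<integral>\<^sup>+p. ennreal (f p) \<partial>(lborel \<Otimes>\<^sub>M lborel))"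
    using nn_integral_eq_integral[OF f_int] f0 by (simp add: lborel_prod)
  also have "\<dots> \<le> (\<integral>\<^sup>+w. (\<integral>\<^sup>+u. ennreal (f (u, u + w)) + ennreal (f (u + w, u)) \<partial>lborel) * indicator {0..} w \<partial>lborel)"
    by (rule nn_integral_by_difference) (use fm in \<open>simp add: lborel_prod\<close>)
  also have "\<dots> \<le> (\<integral>\<^sup>+w. ennreal (indicator {0..1} w * B w) \<partial>lborel)"
  proof (rule nn_integral_mono)
    fix w :: real
    show "(\<integral>\<^sup>+u. ennreal (f (u, u + w)) + ennreal (f (u + w, u)) \<partial>lborel) * indicator {0..} w
      \<le> ennreal (indicator {0..1} w * B w)"
      using bound[of w] by (cases "0 \<le> w"; cases "w \<le> 1") auto
  qed
  also have "\<dots> = ennreal (1/3 - c + 2 * c * d + c^2/2)"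
  proof (rule nn_integral_has_integral_lborel)
    have "(\<lambda>w. indicator {0..1} w * B w) = (\<lambda>w. if w \<in> {0..1} then B w else 0)" by auto
    thus "((\<lambda>w. indicator {0..1} w * B w) has_integral (1/3 - c + 2 * c * d + c^2/2)) UNIV"
      using B by (simp only: has_integral_restrict_UNIV)
    show "0 \<le> indicator {0..1} w * B w" for w using B0[of w] by (auto split: split_indicator)
  qed measurable
  finally have "(\<integral>p. f p \<partial>lborel) \<le> 1/3 - c + 2 * c * d + c^2/2"
    using has_integral_nonneg[OF B] B0 by (subst (asm) ennreal_le_iff) auto
  thus ?thesis unfolding set_lebesgue_integral_def f_def d_def by simp
qed

lemma copula_diagonal_integral_range:
  assumes "copula C"
  shows "1/4 \<le> integral {0..1} (\<lambda>u. C u u)" "integral {0..1} (\<lambda>u. C u u) \<le> 1/2"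
proof -
  note b = copula_bounds[OF assms]
  have "continuous_on {0..1} (\<lambda>u. C u u)"
    by (rule copula_continuous_comp[OF assms]) (auto intro: continuous_intros)
  hence i: "(\<lambda>u. C u u) integrable_on {a..c}" if "0 \<le> a" "c \<le> 1" for a c
    by (intro integrable_continuous_interval) (use that in \<open>auto elim: continuous_on_subset\<close>)
  have half: "((\<lambda>u. u) has_integral (1^2/2 - 0^2/2)) {0..1::real}"
    by (rule fundamental_theorem_of_calculus)
      (auto intro!: derivative_eq_intros simp: has_real_derivative_iff_has_vector_derivative[symmetric])
  have "integral {0..1} (\<lambda>u. C u u) \<le> 1^2/2 - 0^2/2"
    by (rule has_integral_le[OF integrable_integral[OF i] half]) (use b in auto)
  thus "integral {0..1} (\<lambda>u. C u u) \<le> 1/2" by simp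
  have "((\<lambda>u. 2*u-1) has_integral ((1^2 - 1) - ((1/2)^2 - 1/2))) {1/2..1::real}"
    by (rule fundamental_theorem_of_calculus)
      (auto intro!: derivative_eq_intros simp: has_real_derivative_iff_has_vector_derivative[symmetric])
  hence "(1^2 - 1) - ((1/2)^2 - 1/2) \<le> integral {1/2..1} (\<lambda>u. C u u)"
    by (rule has_integral_le[OF _ integrable_integral[OF i]]) (use b(5)[of u u for u] in auto)
  moreover have "0 \<le> integral {0..1/2} (\<lambda>u. C u u)"
    by (rule integral_nonneg) (use i b in auto)
  moreover have "integral {0..1/2} (\<lambda>u. C u u) + integral {1/2..1} (\<lambda>u. C u u) = integral {0..1} (\<lambda>u. C u u)"
    by (rule Henstock_Kurzweil_Integration.integral_combine) (use i in auto)
  ultimately show "1/4 \<le> integral {0..1} (\<lambda>u. C u u)" by (simp add: power2_eq_square)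
qed

section \<open>The curves that enclose the region\<close>

text \<open>The convex lower boundary of the region, attained everywhere.\<close>

definition rho_min :: "real \<Rightarrow> real" where "rho_min x = - 1 + 2 * sqrt ((1 + 2 * x) / 3) ^ 3"

text \<open>The concave upper bound given by Jensen's inequality, attained where \<open>|U - V|\<close> can be
  constant.\<close>

definition rho_max :: "real \<Rightarrow> real" where "rho_max x = 1 - 2 / 3 * (1 - x)^2"

text \<open>The affine bounds are applied with the best parameters: \<open>r = sqrt (4d - 1)\<close>, the tangent to
  the convex lower boundary at this value of the footrule, and \<open>c = 1 - 2d\<close>, which is the mean of
  \<open>|U - V|\<close>; here \<open>d\<close> is the integral of the diagonal.\<close>

theorem copula_rho_bounds:
  assumes "copula C"
  shows "spearman_footrule C \<in> {- 1 / 2..1}"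
    and "rho_min (spearman_footrule C) \<le> spearman_rho C"
    and "spearman_rho C \<le> rho_max (spearman_footrule C)"
proof -
  define d where "d = integral {0..1} (\<lambda>u. C u u)"
  have d: "1/4 \<le> d" "d \<le> 1/2" using copula_diagonal_integral_range[OF assms] by (auto simp: d_def)
  have phi: "spearman_footrule C = 6 * d - 2" using footrule_eq[OF assms] by (simp add: d_def)
  show "spearman_footrule C \<in> {- 1 / 2..1}" using d phi by auto
  define r where "r = sqrt (4 * d - 1)"
  have r: "0 \<le> r" "r \<le> 1" using d by (auto simp: r_def)
  have "r^2 = 4 * d - 1" using d by (simp add: r_def)
  hence dr: "d = (r^2 + 1) / 4" by simp
  have "(1 + 2 * (6 * d - 2)) / 3 = 4 * d - 1" by simp
  hence "rho_min (spearman_footrule C) = -1 + 2 * r^3" unfolding rho_min_def phi r_def by metis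
  also have "\<dots> = 12 * (r * d + 1/6 - r/4 - r^3/12) - 3"
    unfolding dr by (simp add: field_simps power2_eq_square power3_eq_cube)
  also have "\<dots> \<le> spearman_rho C"
    using rho_lower_linear[OF assms r] rho_eq[OF assms] by (simp add: d_def)
  finally show "rho_min (spearman_footrule C) \<le> spearman_rho C" .
  define c where "c = 1 - 2 * d"
  have c: "0 \<le> c" "c \<le> 1" using d by (auto simp: c_def)
  have dc: "d = (1 - c) / 2" by (simp add: c_def)
  have "spearman_rho C \<le> 12 * (1/3 - c + 2 * c * d + c^2/2) - 3"
    using rho_upper_linear[OF assms c] by (simp add: spearman_rho_def d_def)
  also have "\<dots> = rho_max (spearman_footrule C)"
    unfolding rho_max_def phi dc by (simp add: field_simps power2_eq_square)
  finally show "spearman_rho C \<le> rho_max (spearman_footrule C)" .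
qed

section \<open>Copulas of measure-preserving maps\<close>

abbreviation unit_lebesgue :: "real measure" where
  "unit_lebesgue \<equiv> restrict_space lborel {0..1}"

definition measure_preserving_unit :: "(real \<Rightarrow> real) \<Rightarrow> bool" where
  "measure_preserving_unit T \<longleftrightarrow> T \<in> borel_measurable borel \<and> (\<forall>x\<in>{0..1}. T x \<in> {0..1}) \<and>
     (\<forall>B\<in>sets borel. measure lborel {x\<in>{0..1}. T x \<in> B} = measure lborel ({0..1} \<inter> B))"

definition map_copula :: "(real \<Rightarrow> real) \<Rightarrow> real \<Rightarrow> real \<Rightarrow> real" where
  "map_copula T u v = measure lborel {x\<in>{0..1}. x \<le> u \<and> T x \<le> v}"

lemma fmeasurable_unit_subset:
  "S \<in> sets borel \<Longrightarrow> S \<subseteq> {0..1::real} \<Longrightarrow> S \<in> fmeasurable lborel"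
  using fmeasurable_cbox[of "0::real" 1] by (auto intro: fmeasurableI2)

text \<open>\<open>map_copula T\<close> is the joint distribution function of \<open>(X, T X)\<close> for \<open>X\<close> uniform. The volume
  of a rectangle is the measure of a set, and the second margin is uniform because \<open>T\<close> preserves
  measure.\<close>

lemma copula_map_copula:
  assumes T: "measure_preserving_unit T"
  shows "copula (map_copula T)"
proof -
  have [measurable]: "T \<in> borel_measurable borel" and T01: "\<And>x. x \<in> {0..1} \<Longrightarrow> T x \<in> {0..1}"
    and mp: "\<And>B. B \<in> sets borel \<Longrightarrow> measure lborel {x\<in>{0..1}. T x \<in> B} = measure lborel ({0..1} \<inter> B)"
    using T unfolding measure_preserving_unit_def by auto
  define S where "S u v = {x\<in>{0..1}. x \<le> u \<and> T x \<le> v}" for u v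
  have [measurable]: "S u v \<in> sets borel" for u v unfolding S_def by measurable
  have fm: "A \<in> sets borel \<Longrightarrow> A \<subseteq> {0..1} \<Longrightarrow> A \<in> fmeasurable lborel" for A :: "real set"
    by (rule fmeasurable_unit_subset)
  have Sf: "S u v \<in> fmeasurable lborel" for u v
    by (rule fm) (auto simp: S_def)
  have mc: "map_copula T u v = measure lborel (S u v)" for u v by (simp add: map_copula_def S_def)
  have le1: "map_copula T u v \<in> {0..1}" for u v
  proof -
    have "measure lborel (S u v) \<le> measure lborel {0..1::real}"
      by (rule measure_mono_fmeasurable) (auto simp: S_def fm)
    thus ?thesis by (simp add: mc)
  qed
  have z: "map_copula T 0 v = 0" for v
  proof -
    have "measure lborel (S 0 v) \<le> measure lborel {0::real}"
      by (rule measure_mono_fmeasurable) (auto simp: S_def fm)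
    thus ?thesis by (auto simp: mc intro: antisym)
  qed
  have o1: "map_copula T 1 v = v" if "v \<in> {0..1}" for v
  proof -
    have "S 1 v = {x\<in>{0..1}. T x \<in> {..v}}" by (auto simp: S_def)
    hence "map_copula T 1 v = measure lborel ({0..1} \<inter> {..v})" using mp[of "{..v}"] mc by simp
    also have "{0..1} \<inter> {..v} = {0..v}" using that by auto
    finally show ?thesis using that by simp
  qed
  have o2: "map_copula T u 1 = u" if "u \<in> {0..1}" for u
  proof -
    have "x \<in> S u 1 \<longleftrightarrow> x \<in> {0..u}" for x using T01[of x] that unfolding S_def by fastforce
    hence "S u 1 = {0..u}" by blast
    hence "map_copula T u 1 = measure lborel {0..u}" using mc by simp
    thus ?thesis using that by simp
  qed
  have z2: "map_copula T u 0 = 0" for u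
  proof -
    have "S u 0 \<subseteq> S 1 0" by (auto simp: S_def)
    hence "measure lborel (S u 0) \<le> measure lborel (S 1 0)"
      by (rule measure_mono_fmeasurable) (auto intro: Sf)
    also have "\<dots> = 0" using o1[of 0] unfolding mc by simp
    finally show ?thesis unfolding mc by (intro antisym measure_nonneg)
  qed
  have inc: "map_copula T u\<^sub>2 v\<^sub>2 - map_copula T u\<^sub>2 v\<^sub>1 - map_copula T u\<^sub>1 v\<^sub>2 + map_copula T u\<^sub>1 v\<^sub>1 \<ge> 0"
    if "u\<^sub>1 \<le> u\<^sub>2" "v\<^sub>1 \<le> v\<^sub>2" for u\<^sub>1 u\<^sub>2 v\<^sub>1 v\<^sub>2
  proof -
    have d: "map_copula T u\<^sub>2 v - map_copula T u\<^sub>1 v = measure lborel (S u\<^sub>2 v - S u\<^sub>1 v)" for v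
    proof -
      have "S u\<^sub>1 v \<subseteq> S u\<^sub>2 v" using that by (auto simp: S_def)
      thus ?thesis unfolding mc by (rule measurable_measure_Diff[OF Sf _, symmetric, rotated]) simp
    qed
    have "measure lborel (S u\<^sub>2 v\<^sub>1 - S u\<^sub>1 v\<^sub>1) \<le> measure lborel (S u\<^sub>2 v\<^sub>2 - S u\<^sub>1 v\<^sub>2)"
    proof (rule measure_mono_fmeasurable)
      show "S u\<^sub>2 v\<^sub>1 - S u\<^sub>1 v\<^sub>1 \<subseteq> S u\<^sub>2 v\<^sub>2 - S u\<^sub>1 v\<^sub>2" using that by (auto simp: S_def)
      show "S u\<^sub>2 v\<^sub>2 - S u\<^sub>1 v\<^sub>2 \<in> fmeasurable lborel" by (rule fm) (auto simp: S_def)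
    qed simp
    thus ?thesis using d[of v\<^sub>1] d[of v\<^sub>2] by linarith
  qed
  show ?thesis unfolding copula_def using le1 z z2 o1 o2 inc by auto
qed

lemma measure_preserving_integral:
  fixes g :: "real \<Rightarrow> real"
  assumes T: "measure_preserving_unit T" and g: "continuous_on {0..1} g"
  shows "(LINT x:{0..1}|lborel. g (T x)) = (LINT x:{0..1}|lborel. g x)"
    and "set_integrable lborel {0..1} (\<lambda>x. g (T x))"
proof -
  let ?M = unit_lebesgue
  have [measurable]: "T \<in> borel_measurable borel" and T01: "\<And>x. x \<in> {0..1} \<Longrightarrow> T x \<in> {0..1}"
    and mp: "\<And>B. B \<in> sets borel \<Longrightarrow> measure lborel {x\<in>{0..1}. T x \<in> B} = measure lborel ({0..1} \<inter> B)"
    using T unfolding measure_preserving_unit_def by auto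
  have TM: "T \<in> measurable ?M ?M"
    by (rule measurable_restrict_space3) (use T01 in \<open>auto simp: \<close>)
  have "distr ?M ?M T = ?M"
  proof (rule measure_eqI)
    fix A assume "A \<in> sets (distr ?M ?M T)"
    hence A: "A \<in> sets ?M" by simp
    then obtain A' where A': "A' \<in> sets borel" "A = {0..1} \<inter> A'" by (auto simp: sets_restrict_space)
    have AA: "A \<subseteq> {0..1}" "A \<in> sets borel" using A' by auto
    have 1: "{x\<in>{0..1}. T x \<in> A} \<in> fmeasurable lborel" by (rule fmeasurable_unit_subset) (use AA(2) in measurable, auto)
    have 2: "A \<in> fmeasurable lborel" by (rule fmeasurable_unit_subset) (use AA in auto)
    have "emeasure (distr ?M ?M T) A = emeasure ?M (T -` A \<inter> space ?M)"
      by (rule emeasure_distr[OF TM A])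
    also have "T -` A \<inter> space ?M = {x\<in>{0..1}. T x \<in> A}" by (auto simp: space_restrict_space)
    also have "emeasure ?M \<dots> = emeasure lborel \<dots>" by (rule emeasure_restrict_space) auto
    also have "\<dots> = emeasure lborel A"
      using mp[OF AA(2)] AA 1 2 by (simp add: emeasure_eq_measure2 fmeasurableD2 Int_absorb1)
    also have "\<dots> = emeasure ?M A" by (rule emeasure_restrict_space[symmetric]) (use AA in auto)
    finally show "emeasure (distr ?M ?M T) A = emeasure ?M A" .
  qed simp
  moreover have gi: "set_integrable lborel {0..1} g" by (rule borel_integrable_atLeastAtMost'[OF g])
  hence giM: "integrable ?M g" by (simp add: set_integrable_def integrable_restrict_space)
  ultimately have "integral\<^sup>L ?M g = integral\<^sup>L ?M (\<lambda>x. g (T x))" "integrable ?M (\<lambda>x. g (T x))"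
    using integral_distr[OF TM, of g] integrable_distr[OF TM, of g] by auto
  thus "(LINT x:{0..1}|lborel. g (T x)) = (LINT x:{0..1}|lborel. g x)"
    "set_integrable lborel {0..1} (\<lambda>x. g (T x))"
    by (auto simp: set_lebesgue_integral_def set_integrable_def integral_restrict_space integrable_restrict_space)
qed

text \<open>Fubini's theorem for the indicator of a bounded set.\<close>

lemma integral_measure_sections:
  fixes S :: "('a::euclidean_space \<times> 'b::euclidean_space) set"
  assumes [measurable]: "S \<in> sets borel" and "bounded S" "S \<subseteq> P \<times> I"
    and [measurable]: "P \<in> sets borel" "I \<in> sets borel"
  shows "(LINT p:P|lborel. measure lborel {x. (p, x) \<in> S}) = (LINT x:I|lborel. measure lborel {p. (p, x) \<in> S})"
proof -
  have Sm[measurable]: "S \<in> sets (lborel \<Otimes>\<^sub>M lborel)" by (simp only: lborel_prod sets_lborel assms(1))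
  obtain a where a: "S \<subseteq> cbox (-a) a" using bounded_subset_cbox_symmetric[OF \<open>bounded S\<close>] by blast
  have f1: "emeasure lborel {x. (p, x) \<in> S} \<noteq> \<infinity>" for p
  proof -
    have "{x. (p, x) \<in> S} \<subseteq> cbox (- snd a) (snd a)"
      using a by (cases a) (auto simp: cbox_Pair_iff)
    hence "bounded {x. (p, x) \<in> S}" using bounded_cbox bounded_subset by blast
    thus ?thesis using emeasure_bounded_finite by fastforce
  qed
  have f2: "emeasure lborel {p. (p, x) \<in> S} \<noteq> \<infinity>" for x
  proof -
    have "{p. (p, x) \<in> S} \<subseteq> cbox (- fst a) (fst a)"
      using a by (cases a) (auto simp: cbox_Pair_iff)
    hence "bounded {p. (p, x) \<in> S}" using bounded_cbox bounded_subset by blast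
    thus ?thesis using emeasure_bounded_finite by fastforce
  qed
  have m1: "(\<lambda>p. emeasure lborel {x. (p, x) \<in> S}) \<in> borel_measurable lborel"
    using lborel.measurable_emeasure_Pair[OF Sm] by (simp add: vimage_def)
  have m2: "(\<lambda>x. emeasure lborel {p. (p, x) \<in> S}) \<in> borel_measurable lborel"
    using lborel_pair.measurable_emeasure_Pair2[OF Sm] by (simp add: vimage_def)
  have i1: "(LINT p:P|lborel. measure lborel {x. (p, x) \<in> S}) = enn2real (emeasure (lborel \<Otimes>\<^sub>M lborel) S)"
  proof -
    have "(LINT p:P|lborel. measure lborel {x. (p, x) \<in> S}) =
      enn2real (\<integral>\<^sup>+p. ennreal (indicator P p *\<^sub>R measure lborel {x. (p, x) \<in> S}) \<partial>lborel)"
      unfolding set_lebesgue_integral_def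
      by (rule integral_eq_nn_integral) (use m1 in \<open>auto simp: measure_def\<close>)
    also have "(\<integral>\<^sup>+p. ennreal (indicator P p *\<^sub>R measure lborel {x. (p, x) \<in> S}) \<partial>lborel)
      = (\<integral>\<^sup>+p. emeasure lborel {x. (p, x) \<in> S} \<partial>lborel)"
    proof (rule nn_integral_cong)
      fix p :: 'a
      show "ennreal (indicator P p *\<^sub>R measure lborel {x. (p, x) \<in> S}) = emeasure lborel {x. (p, x) \<in> S}"
      proof (cases "p \<in> P")
        case False
        hence "{x. (p, x) \<in> S} = {}" using assms(3) by auto
        thus ?thesis using False by simp
      qed (use f1 in \<open>auto simp: emeasure_eq_ennreal_measure\<close>)
    qed
    finally show ?thesis by (simp add: lborel.emeasure_pair_measure_alt[OF Sm] vimage_def)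
  qed
  have i2: "(LINT x:I|lborel. measure lborel {p. (p, x) \<in> S}) = enn2real (emeasure (lborel \<Otimes>\<^sub>M lborel) S)"
  proof -
    have "(LINT x:I|lborel. measure lborel {p. (p, x) \<in> S}) =
      enn2real (\<integral>\<^sup>+x. ennreal (indicator I x *\<^sub>R measure lborel {p. (p, x) \<in> S}) \<partial>lborel)"
      unfolding set_lebesgue_integral_def
      by (rule integral_eq_nn_integral) (use m2 in \<open>auto simp: measure_def\<close>)
    also have "(\<integral>\<^sup>+x. ennreal (indicator I x *\<^sub>R measure lborel {p. (p, x) \<in> S}) \<partial>lborel)
      = (\<integral>\<^sup>+x. emeasure lborel {p. (p, x) \<in> S} \<partial>lborel)"
    proof (rule nn_integral_cong)
      fix x :: 'b
      show "ennreal (indicator I x *\<^sub>R measure lborel {p. (p, x) \<in> S}) = emeasure lborel {p. (p, x) \<in> S}"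
      proof (cases "x \<in> I")
        case False
        hence "{p. (p, x) \<in> S} = {}" using assms(3) by auto
        thus ?thesis using False by simp
      qed (use f2 in \<open>auto simp: emeasure_eq_ennreal_measure\<close>)
    qed
    finally show ?thesis by (simp add: lborel_pair.emeasure_pair_measure_alt2[OF Sm] vimage_def)
  qed
  show ?thesis using i1 i2 by simp
qed

text \<open>Exchanging the order of integration turns \<open>\<integral>C(u,u) du\<close> into \<open>\<integral>(1 - max x (T x)) dx\<close> and
  \<open>\<integral>\<integral>C\<close> into \<open>\<integral>(1 - x)(1 - T x) dx\<close>. Then \<open>max x y = (x + y + |x - y|)/2\<close> and
  \<open>2xy = x\<^sup>2 + y\<^sup>2 - (x - y)\<^sup>2\<close> are applied, where the moments of \<open>T x\<close> agree with those of \<open>x\<close>.\<close>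

lemma map_copula_measures:
  assumes T: "measure_preserving_unit T"
  shows "spearman_footrule (map_copula T) = 1 - 3 * (LINT x:{0..1}|lborel. \<bar>x - T x\<bar>)" (is ?F)
    and "spearman_rho (map_copula T) = 1 - 6 * (LINT x:{0..1}|lborel. (x - T x)^2)" (is ?R)
proof -
  have [measurable]: "T \<in> borel_measurable borel" and T01: "\<And>x. x \<in> {0..1} \<Longrightarrow> T x \<in> {0..1}"
    using T unfolding measure_preserving_unit_def by auto
  have mi: "(LINT x:{0..1}|lborel. g (T x)) = (LINT x:{0..1}|lborel. g x)"
    "set_integrable lborel {0..1} (\<lambda>x. g (T x))" "set_integrable lborel {0..1} g"
    if "continuous_on {0..1} g" for g :: "real \<Rightarrow> real"
    using measure_preserving_integral[OF T that] borel_integrable_atLeastAtMost'[OF that] by auto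
  have ib: "set_integrable lborel {0..1} h" if [measurable]: "h \<in> borel_measurable borel"
    and "\<And>x. x \<in> {0..1} \<Longrightarrow> \<bar>h x\<bar> \<le> 1" for h :: "real \<Rightarrow> real"
    unfolding set_integrable_def
    by (rule Bochner_Integration.integrable_bound[of _ "indicator {0..1} :: real \<Rightarrow> real"])
      (use that in \<open>auto split: split_indicator\<close>)
  have val: "(LINT x:{0..1}|lborel. x) = (1/2 :: real)" "(LINT x:{0..1}|lborel. x^2) = (1/3::real)"
  proof -
    have "((\<lambda>x. x) has_integral (1^2/2 - 0^2/2)) {0..1::real}"
      by (rule fundamental_theorem_of_calculus)
        (auto intro!: derivative_eq_intros simp: has_real_derivative_iff_has_vector_derivative[symmetric])
    thus "(LINT x:{0..1}|lborel. x) = (1/2 :: real)"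
      by (subst set_borel_integral_eq_integral(2))
        (auto intro!: borel_integrable_atLeastAtMost' continuous_intros simp: integral_unique)
    have "((\<lambda>x. x^2) has_integral (1^3/3 - 0^3/3)) {0..1::real}"
      by (rule fundamental_theorem_of_calculus)
        (auto intro!: derivative_eq_intros simp: has_real_derivative_iff_has_vector_derivative[symmetric])
    thus "(LINT x:{0..1}|lborel. x^2) = (1/3 :: real)"
      by (subst set_borel_integral_eq_integral(2))
        (auto intro!: borel_integrable_atLeastAtMost' continuous_intros simp: integral_unique)
  qed
  have valT: "(LINT x:{0..1}|lborel. T x) = 1/2" "(LINT x:{0..1}|lborel. (T x)^2) = 1/3"
    using mi(1)[OF continuous_on_id] mi(1)[OF continuous_on_power[OF continuous_on_id], of 2] val by auto
  have val1: "(LINT x::real:{0..1}|lborel. 1::real) = 1" unfolding set_lebesgue_integral_def by simp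
  have bd: "\<bar>x\<bar> \<le> 1 \<and> \<bar>T x\<bar> \<le> 1 \<and> \<bar>x^2\<bar> \<le> 1 \<and> \<bar>(T x)^2\<bar> \<le> 1 \<and> \<bar>x - T x\<bar> \<le> 1 \<and> \<bar>(x - T x)^2\<bar> \<le> 1"
    if "x \<in> {0..1}" for x
    using that T01[OF that] by (auto simp: abs_square_le_1)
  have i0: "set_integrable lborel {0..1} (\<lambda>x. x::real)"
  proof (rule ib)
    show "(\<lambda>x. x::real) \<in> borel_measurable borel" by measurable
  qed (use bd in simp)
  have i1: "set_integrable lborel {0..1} (\<lambda>x. T x)"
  proof (rule ib)
    show "(\<lambda>x. T x) \<in> borel_measurable borel" by measurable
  qed (use bd in simp)
  have i2: "set_integrable lborel {0..1} (\<lambda>x. (x::real)^2)"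
  proof (rule ib)
    show "(\<lambda>x. (x::real)^2) \<in> borel_measurable borel" by measurable
  qed (use bd in simp)
  have i3: "set_integrable lborel {0..1} (\<lambda>x. (T x)^2)"
  proof (rule ib)
    show "(\<lambda>x. (T x)^2) \<in> borel_measurable borel" by measurable
  qed (use bd in simp)
  have i4: "set_integrable lborel {0..1} (\<lambda>x. \<bar>x - T x\<bar>)"
  proof (rule ib)
    show "(\<lambda>x. \<bar>x - T x\<bar>) \<in> borel_measurable borel" by measurable
  qed (use bd in simp)
  have i5: "set_integrable lborel {0..1} (\<lambda>x. (x - T x)^2)"
  proof (rule ib)
    show "(\<lambda>x. (x - T x)^2) \<in> borel_measurable borel" by measurable
  qed (use bd in simp)
  have i6: "set_integrable lborel {0..1} (\<lambda>x::real. 1::real)"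
  proof (rule ib)
    show "(\<lambda>x::real. 1::real) \<in> borel_measurable borel" by measurable
  qed (use bd in simp)
  note i = i0 i1 i2 i3 i4 i5 i6
  show ?F
  proof -
    let ?S = "{(u, x). u \<in> {0..1} \<and> x \<in> {0..1} \<and> x \<le> u \<and> T x \<le> u}"
    have "(LINT u:{0..1}|lborel. map_copula T u u) = (LINT u:{0..1}|lborel. measure lborel {x. (u, x) \<in> ?S})"
      unfolding map_copula_def by (rule set_lebesgue_integral_cong) (auto intro!: arg_cong[where f="measure lborel"])
    also have "\<dots> = (LINT x:{0..1}|lborel. measure lborel {u. (u, x) \<in> ?S})"
    proof (rule integral_measure_sections)
      have "{q \<in> space (borel \<Otimes>\<^sub>M borel). fst q \<in> {0..1::real} \<and> snd q \<in> {0..1} \<and> snd q \<le> fst q \<and> T (snd q) \<le> fst q}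
        \<in> sets (borel \<Otimes>\<^sub>M borel)" by measurable
      also have "{q \<in> space (borel \<Otimes>\<^sub>M borel). fst q \<in> {0..1::real} \<and> snd q \<in> {0..1} \<and> snd q \<le> fst q \<and> T (snd q) \<le> fst q} = ?S"
        by (auto simp: space_pair_measure)
      finally show "?S \<in> sets borel" by (simp only: borel_prod)
      show "bounded ?S" by (rule bounded_subset[of "{0..1}\<times>{0..1}"]) (auto intro: bounded_Times)
    qed auto
    also have "\<dots> = (LINT x:{0..1}|lborel. 1 - (x + T x + \<bar>x - T x\<bar>) / 2)"
    proof (rule set_lebesgue_integral_cong)
      show "\<forall>x. x \<in> {0..1} \<longrightarrow> measure lborel {u. (u, x) \<in> ?S} = 1 - (x + T x + \<bar>x - T x\<bar>) / 2"
      proof safe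
        fix x :: real assume x: "x \<in> {0..1}"
        have "{u. (u, x) \<in> ?S} = {max x (T x)..1}" using x by auto
        thus "measure lborel {u. (u, x) \<in> ?S} = 1 - (x + T x + \<bar>x - T x\<bar>) / 2"
          using T01[OF x] x by (auto simp: max_def)
      qed
    qed simp
    also have "\<dots> = 1 - (1/2 + 1/2 + (LINT x:{0..1}|lborel. \<bar>x - T x\<bar>)) / 2"
      using i val val1 valT by (simp add: set_integral_diff set_integral_add)
    finally show ?thesis unfolding spearman_footrule_def by (simp add: field_simps)
  qed
  show ?R
  proof -
    let ?S = "{(p, x). p \<in> {0..1}\<times>{0..1} \<and> x \<in> {0..1} \<and> x \<le> fst p \<and> T x \<le> snd p}"
    have "(LINT p:{0..1}\<times>{0..1}|lborel. map_copula T (fst p) (snd p))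
      = (LINT p:{0..1}\<times>{0..1}|lborel. measure lborel {x. (p, x) \<in> ?S})"
      unfolding map_copula_def by (rule set_lebesgue_integral_cong) (auto intro!: arg_cong[where f="measure lborel"] borel_closed closed_Times)
    also have "\<dots> = (LINT x:{0..1}|lborel. measure lborel {p. (p, x) \<in> ?S})"
    proof (rule integral_measure_sections)
      let ?M = "(borel \<Otimes>\<^sub>M borel) \<Otimes>\<^sub>M borel :: ((real \<times> real) \<times> real) measure"
      have "{q \<in> space ?M. fst (fst q) \<in> {0..1} \<and> snd (fst q) \<in> {0..1} \<and> snd q \<in> {0..1} \<and>
          snd q \<le> fst (fst q) \<and> T (snd q) \<le> snd (fst q)} \<in> sets ?M" by measurable
      also have "{q \<in> space ?M. fst (fst q) \<in> {0..1} \<and> snd (fst q) \<in> {0..1} \<and> snd q \<in> {0..1} \<and>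
          snd q \<le> fst (fst q) \<and> T (snd q) \<le> snd (fst q)} = ?S"
        by (auto simp: space_pair_measure)
      finally show "?S \<in> sets borel" by (simp only: borel_prod)
      show "bounded ?S" by (rule bounded_subset[of "({0..1}\<times>{0..1})\<times>{0..1}"]) (auto intro!: bounded_Times)
    qed (auto intro!: borel_closed closed_Times)
    also have "\<dots> = (LINT x:{0..1}|lborel. 1 - x - T x + (x^2 + (T x)^2 - (x - T x)^2) / 2)"
    proof (rule set_lebesgue_integral_cong)
      show "\<forall>x. x \<in> {0..1} \<longrightarrow> measure lborel {p. (p, x) \<in> ?S} = 1 - x - T x + (x^2 + (T x)^2 - (x - T x)^2) / 2"
      proof safe
        fix x :: real assume x: "x \<in> {0..1}"
        have "{p. (p, x) \<in> ?S} = cbox (x, T x) (1, 1)" using x T01[OF x] by (auto simp: cbox_Pair_iff)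
        moreover have "measure lborel (cbox (x, T x) (1, 1)) = (1 - x) * (1 - T x)"
          using x T01[OF x] by (simp add: content_Pair)
        ultimately show "measure lborel {p. (p, x) \<in> ?S} = 1 - x - T x + (x^2 + (T x)^2 - (x - T x)^2) / 2"
          by (simp add: field_simps power2_eq_square)
      qed
    qed simp
    also have "\<dots> = 1 - 1/2 - 1/2 + (1/3 + 1/3 - (LINT x:{0..1}|lborel. (x - T x)^2)) / 2"
      using i val val1 valT by (simp add: set_integral_diff set_integral_add)
    finally show ?thesis unfolding spearman_rho_def by (simp add: field_simps)
  qed
qed

text \<open>A criterion that is checked by case distinction: \<open>T\<close> is an involution that acts piecewise as
  one of finitely many translations and reflections. On the piece where \<open>T x = s x + c\<close> with
  \<open>s = 1\<close> or \<open>s = -1\<close>, the preimage of \<open>B\<close> is the preimage under this isometry of the part of \<open>B\<close>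
  that \<open>T\<close> sends into the piece, and these parts of \<open>B\<close> form a partition of it.\<close>

lemma measure_preserving_involution:
  assumes T[measurable]: "T \<in> borel_measurable borel"
    and T01: "\<And>x. x \<in> {0..1} \<Longrightarrow> T x \<in> {0..1}"
    and inv: "\<And>x. x \<in> {0..1} \<Longrightarrow> T (T x) = x"
    and K: "finite K" "\<And>x. x \<in> {0..1} \<Longrightarrow> T x - x \<in> K \<or> T x + x \<in> K"
  shows "measure_preserving_unit T"
  unfolding measure_preserving_unit_def
proof (intro conjI ballI)
  fix B :: "real set" assume B[measurable]: "B \<in> sets borel"
  have [measurable]: "K \<in> sets borel" using K(1) by (simp add: borel_closed finite_imp_closed)
  \<comment> \<open>The pieces are the fibres of \<open>j\<close>, which selects one isometry for each point and prefers translations.\<close>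
  define j where "j x = (if T x - x \<in> K then (1::real, T x - x) else (-1, T x + x))" for x
  let ?J = "{1,-1} \<times> K"
  have jJ: "j x \<in> ?J" if "x \<in> {0..1}" for x using K(2)[OF that] by (auto simp: j_def)
  have Tj: "T x = s * x + c" if "j x = (s, c)" for x s c using that by (auto simp: j_def split: if_splits)
  have "j \<in> borel \<rightarrow>\<^sub>M borel \<Otimes>\<^sub>M borel" unfolding j_def by measurable
  hence [measurable]: "j \<in> borel_measurable borel" by (simp only: borel_prod)
  define X where "X i = {x\<in>{0..1}. j x = i \<and> T x \<in> B}" for i
  define Y where "Y i = {y\<in>{0..1}. j (T y) = i \<and> y \<in> B}" for i
  have Xm: "X i \<in> sets borel" for i
  proof -
    have "X i = {x\<in>{0..1}. j x \<in> {i} \<and> T x \<in> B}" by (auto simp: X_def)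
    also have "\<dots> \<in> sets borel" by measurable
    finally show ?thesis .
  qed
  have Ym: "Y i \<in> sets borel" for i
  proof -
    have "Y i = {x\<in>{0..1}. j (T x) \<in> {i} \<and> x \<in> B}" by (auto simp: Y_def)
    also have "\<dots> \<in> sets borel" by measurable
    finally show ?thesis .
  qed
  have eq: "emeasure lborel (X i) = emeasure lborel (Y i)" if "i \<in> ?J" for i
  proof -
    obtain s c where i: "i = (s, c)" "\<bar>s\<bar> = 1" "s \<noteq> 0" "s * s = 1" using \<open>i \<in> ?J\<close> by auto
    \<comment> \<open>The involution property makes the inverse of the isometry on this piece again \<open>T\<close>.\<close>
    have XY: "x \<in> X i \<longleftrightarrow> c + s * x \<in> Y i" for x
    proof
      assume "x \<in> X i"
      hence x: "x \<in> {0..1}" "j x = i" "T x \<in> B" by (auto simp: X_def)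
      have "T x = c + s * x" using Tj[of x s c] x i by simp
      thus "c + s * x \<in> Y i" using x T01[OF x(1)] inv[OF x(1)] by (simp add: Y_def)
    next
      assume "c + s * x \<in> Y i"
      hence y: "c + s * x \<in> {0..1}" "j (T (c + s * x)) = i" "c + s * x \<in> B" by (auto simp: Y_def)
      have "T (T (c + s * x)) = s * T (c + s * x) + c" using Tj[of "T (c + s * x)" s c] y(2) i(1) by simp
      hence "x = T (c + s * x)" using inv[OF y(1)] i(3) by simp
      thus "x \<in> X i" using y T01[OF y(1)] inv[OF y(1)] by (auto simp: X_def)
    qed
    have "emeasure lborel (Y i) = (\<integral>\<^sup>+y. indicator (Y i) y \<partial>lborel)" using Ym by simp
    also have "\<dots> = ennreal \<bar>s\<bar> * (\<integral>\<^sup>+x. indicator (Y i) (c + s * x) \<partial>lborel)"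
      by (rule nn_integral_real_affine) (use Ym i in auto)
    also have "\<dots> = (\<integral>\<^sup>+x. indicator (X i) x \<partial>lborel)"
      using i XY by (simp add: indicator_def)
    finally show ?thesis using Xm by simp
  qed
  have "emeasure lborel {x\<in>{0..1}. T x \<in> B} = emeasure lborel (\<Union>i\<in>?J. X i)"
    using jJ by (intro arg_cong[where f="emeasure lborel"]) (auto simp: X_def)
  also have "\<dots> = (\<Sum>i\<in>?J. emeasure lborel (X i))"
    by (rule sum_emeasure[symmetric]) (use K Xm in \<open>auto simp: disjoint_family_on_def X_def\<close>)
  also have "\<dots> = (\<Sum>i\<in>?J. emeasure lborel (Y i))" using eq by (intro sum.cong) auto
  also have "\<dots> = emeasure lborel (\<Union>i\<in>?J. Y i)"
    by (rule sum_emeasure) (use K Ym in \<open>auto simp: disjoint_family_on_def Y_def\<close>)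
  also have "(\<Union>i\<in>?J. Y i) = {0..1} \<inter> B"
  proof -
    have "y \<in> (\<Union>i\<in>?J. Y i)" if "y \<in> {0..1}" "y \<in> B" for y
      using that jJ[OF T01[OF that(1)]] by (force simp: Y_def)
    thus ?thesis by (auto simp: Y_def)
  qed
  finally show "measure lborel {x\<in>{0..1}. T x \<in> B} = measure lborel ({0..1} \<inter> B)"
    by (simp add: measure_def)
qed (use T01 in auto)

abbreviation region :: "(real \<times> real) set" where
  "region \<equiv> exact_region spearman_footrule spearman_rho"

lemma map_copula_values:
  assumes T: "measure_preserving_unit T"
    and a: "((\<lambda>x. \<bar>x - T x\<bar>) has_integral a) {0..1}"
    and b: "((\<lambda>x. (x - T x)^2) has_integral b) {0..1}"
  shows "spearman_footrule (map_copula T) = 1 - 3 * a" "spearman_rho (map_copula T) = 1 - 6 * b"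
proof -
  have [measurable]: "T \<in> borel_measurable borel" and T01: "\<And>x. x \<in> {0..1} \<Longrightarrow> T x \<in> {0..1}"
    using T unfolding measure_preserving_unit_def by auto
  have ib: "set_integrable lborel {0..1} h" if [measurable]: "h \<in> borel_measurable borel"
    and "\<And>x. x \<in> {0..1} \<Longrightarrow> \<bar>h x\<bar> \<le> 1" for h :: "real \<Rightarrow> real"
    unfolding set_integrable_def
    by (rule Bochner_Integration.integrable_bound[of _ "indicator {0..1} :: real \<Rightarrow> real"])
      (use that in \<open>auto split: split_indicator\<close>)
  have "set_integrable lborel {0..1} (\<lambda>x. \<bar>x - T x\<bar>)"
    by (rule ib, measurable) (use T01 in \<open>force\<close>)
  hence 1: "(LINT x:{0..1}|lborel. \<bar>x - T x\<bar>) = a"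
    using a by (simp add: set_borel_integral_eq_integral integral_unique)
  have "set_integrable lborel {0..1} (\<lambda>x. (x - T x)^2)"
    by (rule ib, measurable) (use T01 in \<open>force simp: abs_square_le_1\<close>)
  hence 2: "(LINT x:{0..1}|lborel. (x - T x)^2) = b"
    using b by (simp add: set_borel_integral_eq_integral integral_unique)
  show "spearman_footrule (map_copula T) = 1 - 3 * a" "spearman_rho (map_copula T) = 1 - 6 * b"
    using map_copula_measures[OF T] 1 2 by auto
qed

lemma map_copula_point:
  assumes "measure_preserving_unit T"
    and "((\<lambda>x. \<bar>x - T x\<bar>) has_integral a) {0..1}"
    and "((\<lambda>x. (x - T x)^2) has_integral b) {0..1}"
  shows "(1 - 3 * a, 1 - 6 * b) \<in> region"
  unfolding exact_region_def using copula_map_copula[OF assms(1)] map_copula_values[OF assms] by force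

lemma has_integral_const_interval:
  fixes f :: "real \<Rightarrow> real"
  assumes "a \<le> b" "\<And>x. a \<le> x \<Longrightarrow> x < b \<Longrightarrow> f x = k"
  shows "(f has_integral k * (b - a)) {a..b}"
proof -
  have "((\<lambda>x. k) has_integral k * (b - a)) {a..b}"
    using has_integral_const_real[of k a b] assms(1) by (simp add: mult.commute)
  thus ?thesis by (rule has_integral_spike_finite[of "{b}", rotated 2]) (use assms in auto)
qed

section \<open>Three families of interval involutions\<close>

text \<open>Reflects the two ends of the unit interval into each other and fixes the middle part of
  length \<open>s\<close>.\<close>

definition end_flip :: "real \<Rightarrow> real \<Rightarrow> real" where
  "end_flip s x = (if s < \<bar>2 * x - 1\<bar> then 1 - x else x)"

text \<open>The displacement is \<open>|2x - 1|\<close> where that exceeds \<open>s\<close>, and zero elsewhere; both moments are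
  computed at once as the \<open>k\<close>-th moment.\<close>

lemma end_flip_values:
  assumes s: "0 \<le> s" "s \<le> 1"
  shows "measure_preserving_unit (end_flip s)"
    and "spearman_footrule (map_copula (end_flip s)) = (3 * s^2 - 1) / 2"
    and "spearman_rho (map_copula (end_flip s)) = 2 * s^3 - 1"
proof -
  show mp: "measure_preserving_unit (end_flip s)"
  proof (rule measure_preserving_involution[where K="{0,1}"])
    show "end_flip s \<in> borel_measurable borel" unfolding end_flip_def by measurable
  qed (auto simp: end_flip_def)
  have *: "(f has_integral (1 - s^(Suc k)) / (Suc k)) {0..1}"
    if f: "\<And>x. x \<in> {0..1} \<Longrightarrow> f x = \<bar>x - end_flip s x\<bar>^k" and k: "0 < k" for f :: "real \<Rightarrow> real" and k
  proof -
    let ?F = "\<lambda>x::real. (2 * x - 1)^(Suc k) / (2 * real (Suc k))"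
    let ?G = "\<lambda>x::real. - ((1 - 2 * x)^(Suc k) / (2 * real (Suc k)))"
    have dF: "(?F has_real_derivative (2 * x - 1)^k) (at x within A)" for x A
      by (rule derivative_eq_intros refl | simp add: divide_simps)+
    have dG: "(?G has_real_derivative (1 - 2 * x)^k) (at x within A)" for x A
      by (rule derivative_eq_intros refl | simp add: divide_simps)+
    define a b where "a = (1 - s) / 2" and "b = (1 + s) / 2"
    have ab: "0 \<le> a" "a \<le> b" "b \<le> 1" "1 - 2 * a = s" "2 * b - 1 = s" "a \<le> 1/2" "1/2 \<le> b"
      using s by (auto simp: a_def b_def field_simps)
    have 1: "(f has_integral (?G a - ?G 0)) {0..a}"
    proof (rule has_integral_spike_finite[of "{a}"])
      show "((\<lambda>x. (1 - 2 * x)^k) has_integral (?G a - ?G 0)) {0..a}"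
        by (rule fundamental_theorem_of_calculus)
          (use ab dG in \<open>auto simp: has_real_derivative_iff_has_vector_derivative[symmetric]\<close>)
    qed (use ab in \<open>auto simp: f end_flip_def abs_if\<close>)
    have 2: "(f has_integral (0 * (b - a))) {a..b}"
      by (rule has_integral_const_interval)
        (use ab k in \<open>auto simp: f end_flip_def abs_if zero_power split: if_splits\<close>)
    have 3: "(f has_integral (?F 1 - ?F b)) {b..1}"
    proof (rule has_integral_spike_finite[of "{b}"])
      show "((\<lambda>x. (2 * x - 1)^k) has_integral (?F 1 - ?F b)) {b..1}"
        by (rule fundamental_theorem_of_calculus)
          (use ab dF in \<open>auto simp: has_real_derivative_iff_has_vector_derivative[symmetric]\<close>)
    qed (use ab in \<open>auto simp: f end_flip_def abs_if\<close>)
    have "(f has_integral ((?G a - ?G 0 + 0 * (b - a)) + (?F 1 - ?F b))) {0..1}"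
      by (rule has_integral_combine[OF _ _ has_integral_combine[OF _ _ 1 2] 3]) (use ab in auto)
    moreover have "(- (q / (2 * K)) - - (1 / (2 * K)) + 0 * (b - a)) + (1 / (2 * K) - q / (2 * K)) = (1 - q) / K"
      if "0 < K" for q K :: real
      using that by (simp add: field_simps)
    from this[of "real (Suc k)" "s ^ Suc k"]
    have "(?G a - ?G 0 + 0 * (b - a)) + (?F 1 - ?F b) = (1 - s ^ Suc k) / real (Suc k)"
      unfolding ab(4,5) by (simp del: power_Suc of_nat_Suc)
    ultimately show ?thesis by simp
  qed
  have "((\<lambda>x. \<bar>x - end_flip s x\<bar>) has_integral (1 - s^(Suc 1)) / (Suc 1)) {0..1}"
    by (rule *) auto
  moreover have "((\<lambda>x. (x - end_flip s x)^2) has_integral (1 - s^(Suc 2)) / (Suc 2)) {0..1}"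
    by (rule *) auto
  ultimately have "spearman_footrule (map_copula (end_flip s)) = 1 - 3 * ((1 - s^(Suc 1)) / (Suc 1))"
    "spearman_rho (map_copula (end_flip s)) = 1 - 6 * ((1 - s^(Suc 2)) / (Suc 2))"
    by (rule map_copula_values[OF mp])+
  thus "spearman_footrule (map_copula (end_flip s)) = (3 * s^2 - 1) / 2"
    "spearman_rho (map_copula (end_flip s)) = 2 * s^3 - 1"
    by (simp_all add: field_simps eval_nat_numeral)
qed

text \<open>For \<open>s = 0\<close> the flip is \<open>x \<mapsto> 1 - x\<close>, whose copula is \<open>W\<close>.\<close>

lemma frechet_lower_values:
  "spearman_footrule frechet_lower = - 1 / 2" "spearman_rho frechet_lower = - 1"
proof -
  have eq: "map_copula (end_flip 0) u v = frechet_lower u v" if "u \<in> {0..1}" "v \<in> {0..1}" for u v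
  proof -
    have "end_flip 0 x = 1 - x" for x by (auto simp: end_flip_def)
    hence "{x\<in>{0..1}. x \<le> u \<and> end_flip 0 x \<le> v} = {1-v..u}" using that by auto
    thus ?thesis unfolding map_copula_def frechet_lower_def by (simp add: max_def)
  qed
  have "(LINT u:{0..1}|lborel. frechet_lower u u) = (LINT u:{0..1}|lborel. map_copula (end_flip 0) u u)"
    by (rule set_lebesgue_integral_cong) (auto simp: eq)
  thus "spearman_footrule frechet_lower = - 1 / 2"
    using end_flip_values(2)[of 0] by (simp add: spearman_footrule_def)
  have "(LINT p:{0..1}\<times>{0..1}|lborel. frechet_lower (fst p) (snd p))
      = (LINT p:{0..1}\<times>{0..1}|lborel. map_copula (end_flip 0) (fst p) (snd p))"
    by (rule set_lebesgue_integral_cong) (auto simp: eq intro!: borel_closed closed_Times)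
  thus "spearman_rho frechet_lower = - 1"
    using end_flip_values(3)[of 0] by (simp add: spearman_rho_def)
qed

text \<open>Cuts the unit interval into \<open>2n\<close> blocks of equal length and exchanges the blocks of each
  consecutive pair. The point 1 is fixed so that the closed interval is mapped to itself.\<close>

definition block_swap :: "nat \<Rightarrow> real \<Rightarrow> real" where
  "block_swap n x = (if 1 \<le> x then x
     else if even \<lfloor>2 * real n * x\<rfloor> then x + 1 / (2 * real n) else x - 1 / (2 * real n))"

text \<open>Every point except 1 moves by exactly \<open>d = 1/(2n)\<close>, so the second moment of the displacement
  is the square of the first, which is the equality case of Jensen's inequality.\<close>

lemma block_swap_point:
  assumes n: "0 < n"
  shows "(1 - 3 / (2 * real n), 1 - 3 / (2 * (real n)^2)) \<in> region"
proof -
  define d where "d = 1 / (2 * real n)"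
  have d: "0 < d" "2 * real n * d = 1" using n by (auto simp: d_def)
  define fl where "fl x = \<lfloor>2 * real n * x\<rfloor>" for x
  have def: "block_swap n x = (if 1 \<le> x then x else if even (fl x) then x + d else x - d)" for x
    by (simp add: block_swap_def d_def fl_def)
  have "2 * real n * (x + d) = 2 * real n * x + 1" "2 * real n * (x - d) = 2 * real n * x - 1" for x
    using d by (auto simp: algebra_simps)
  hence fl_shift: "fl (x + d) = fl x + 1" "fl (x - d) = fl x - 1" for x
    unfolding fl_def by simp_all
  have lt: "x < 1 \<longleftrightarrow> fl x < 2 * int n" for x
  proof -
    have "x < 1 \<longleftrightarrow> 2 * real n * x < of_int (2 * int n)" using n by simp
    also have "\<dots> \<longleftrightarrow> fl x < 2 * int n" unfolding fl_def by (rule floor_less_iff[symmetric])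
    finally show ?thesis .
  qed
  have ge: "0 \<le> x \<longleftrightarrow> 0 \<le> fl x" for x
    using n by (simp add: fl_def zero_le_mult_iff)
  have even_up: "0 \<le> x + d \<and> x + d < 1" if "0 \<le> x" "x < 1" "even (fl x)" for x
  proof -
    have "fl x < 2 * int n" using that lt by blast
    hence "fl x + 1 < 2 * int n" using that(3) by presburger
    hence "x + d < 1" using lt[of "x + d"] fl_shift(1)[of x] by simp
    thus ?thesis using that d by simp
  qed
  have odd_down: "0 \<le> x - d \<and> x - d < 1" if "0 \<le> x" "x < 1" "odd (fl x)" for x
  proof -
    have "0 \<le> fl x" using that ge by blast
    hence "0 \<le> fl x - 1" using that(3) by presburger
    hence "0 \<le> x - d" using ge[of "x - d"] fl_shift(2)[of x] by simp
    thus ?thesis using that d by simp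
  qed
  have mp: "measure_preserving_unit (block_swap n)"
  proof (rule measure_preserving_involution[where K="{0,d,-d}"])
    show "block_swap n \<in> borel_measurable borel" unfolding block_swap_def by measurable
  next
    fix x :: real assume x: "x \<in> {0..1}"
    consider "1 \<le> x" | "x < 1" "even (fl x)" | "x < 1" "odd (fl x)" by linarith
    hence "block_swap n x \<in> {0..1} \<and> block_swap n (block_swap n x) = x"
    proof cases
      case 1 thus ?thesis using x by (simp add: def)
    next
      case 2
      thus ?thesis using x even_up[of x] fl_shift(1)[of x] by (simp add: def)
    next
      case 3
      thus ?thesis using x odd_down[of x] fl_shift(2)[of x] by (simp add: def)
    qed
    thus "block_swap n x \<in> {0..1}" "block_swap n (block_swap n x) = x" by auto
  qed (auto simp: def)
  have "((\<lambda>x. \<bar>x - block_swap n x\<bar>) has_integral d * (1 - 0)) {0..1}"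
    by (rule has_integral_const_interval) (use d in \<open>auto simp: def\<close>)
  moreover have "((\<lambda>x. (x - block_swap n x)^2) has_integral d^2 * (1 - 0)) {0..1}"
    by (rule has_integral_const_interval) (use d in \<open>auto simp: def\<close>)
  ultimately have "(1 - 3 * (d * (1 - 0)), 1 - 6 * (d^2 * (1 - 0))) \<in> region"
    by (rule map_copula_point[OF mp])
  thus ?thesis by (simp add: d_def power_divide power_mult_distrib)
qed

text \<open>Six intervals, exchanged in pairs: the first and third and the fourth and sixth, of length
  \<open>t\<close>, by translations of \<open>1/2 - t\<close>, and the second and fifth, of length \<open>1/2 - 2t\<close>, by a
  translation of \<open>1/2\<close>.\<close>

definition two_distance_swap :: "real \<Rightarrow> real \<Rightarrow> real" where
  "two_distance_swap t x =
    (if x < t then x + (1/2 - t) else if x < 1/2 - t then x + 1/2 else if x < 1/2 then x - (1/2 - t)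
     else if x < 1/2 + t then x + (1/2 - t) else if x < 1 - t then x - 1/2
     else if x < 1 then x - (1/2 - t) else x)"

text \<open>The displacement is \<open>1/2 - t\<close> on a set of measure \<open>4t\<close> and \<open>1/2\<close> almost everywhere else. At
  \<open>t = 0\<close> and \<open>t = 1/4\<close> the map is \<open>block_swap 1\<close> and \<open>block_swap 2\<close>. In between, the variance of
  the displacement stays small, so that the resulting curve runs above the chord between these two
  points.\<close>

lemma two_distance_swap_point:
  assumes t: "0 \<le> t" "t \<le> 1/4"
  shows "(12 * t^2 - 1/2, 24 * t^2 - 24 * t^3 - 1/2) \<in> region"
proof -
  let ?T = "two_distance_swap t"
  have mp: "measure_preserving_unit ?T"
  proof (rule measure_preserving_involution[where K="{0,1/2,-1/2,1/2-t,-(1/2-t)}"])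
    show "?T \<in> borel_measurable borel" unfolding two_distance_swap_def by measurable
  next
    fix x :: real assume "x \<in> {0..1}"
    thus "?T x \<in> {0..1}" "?T (?T x) = x"
      using t by (auto simp: two_distance_swap_def)
  qed (auto simp: two_distance_swap_def)
  have *: "(f has_integral (4 * t * (1/2 - t)^k + (1 - 4 * t) * (1/2)^k)) {0..1}"
    if f: "\<And>x. f x = \<bar>x - ?T x\<bar>^k" for f k
  proof -
    let ?p = "(1/2 - t)^k" and ?h = "(1/2::real)^k"
    note c = has_integral_const_interval
    have 1: "(f has_integral ?p * (t - 0)) {0..t}"
      by (rule c) (use t in \<open>auto simp: f two_distance_swap_def\<close>)
    have 2: "(f has_integral ?h * ((1/2 - t) - t)) {t..1/2-t}"
      by (rule c) (use t in \<open>auto simp: f two_distance_swap_def\<close>)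
    have 3: "(f has_integral ?p * (1/2 - (1/2 - t))) {1/2-t..1/2}"
      by (rule c) (use t in \<open>auto simp: f two_distance_swap_def\<close>)
    have 4: "(f has_integral ?p * ((1/2+t) - 1/2)) {1/2..1/2+t}"
      by (rule c) (use t in \<open>auto simp: f two_distance_swap_def\<close>)
    have 5: "(f has_integral ?h * ((1-t) - (1/2+t))) {1/2+t..1-t}"
      by (rule c) (use t in \<open>auto simp: f two_distance_swap_def\<close>)
    have 6: "(f has_integral ?p * (1 - (1-t))) {1-t..1}"
      by (rule c) (use t in \<open>auto simp: f two_distance_swap_def\<close>)
    have "(f has_integral (((((?p * (t - 0) + ?h * ((1/2 - t) - t)) + ?p * (1/2 - (1/2 - t)))
        + ?p * ((1/2+t) - 1/2)) + ?h * ((1-t) - (1/2+t))) + ?p * (1 - (1-t)))) {0..1}"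
      by (rule has_integral_combine[OF _ _ has_integral_combine[OF _ _ has_integral_combine[OF _ _
          has_integral_combine[OF _ _ has_integral_combine[OF _ _ 1 2] 3] 4] 5] 6]) (use t in auto)
    thus ?thesis by (rule has_integral_eq_rhs) (simp add: algebra_simps)
  qed
  have "((\<lambda>x. \<bar>x - ?T x\<bar>) has_integral (4 * t * (1/2 - t)^1 + (1 - 4 * t) * (1/2)^1)) {0..1}"
    by (rule *) simp
  moreover have "((\<lambda>x. (x - ?T x)^2) has_integral (4 * t * (1/2 - t)^2 + (1 - 4 * t) * (1/2)^2)) {0..1}"
    by (rule *) simp
  ultimately have "(1 - 3 * (4 * t * (1/2 - t)^1 + (1 - 4 * t) * (1/2)^1),
      1 - 6 * (4 * t * (1/2 - t)^2 + (1 - 4 * t) * (1/2)^2)) \<in> region"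
    by (rule map_copula_point[OF mp])
  moreover have "1 - 3 * (4 * t * (1/2 - t)^1 + (1 - 4 * t) * (1/2)^1) = 12 * t^2 - 1/2"
    "1 - 6 * (4 * t * (1/2 - t)^2 + (1 - 4 * t) * (1/2)^2) = 24 * t^2 - 24 * t^3 - 1/2"
    by (simp_all add: field_simps power2_eq_square power3_eq_cube)
  ultimately show ?thesis by simp
qed

section \<open>Convexity of the region and its area from above\<close>

lemma convex_region: "convex region"
proof (rule convexI)
  fix p q :: "real \<times> real" and a b :: real
  assume p: "p \<in> region" and q: "q \<in> region" and ab: "0 \<le> a" "0 \<le> b" "a + b = 1"
  obtain C D where C: "copula C" "p = (spearman_footrule C, spearman_rho C)"
    and D: "copula D" "q = (spearman_footrule D, spearman_rho D)"
    using p q unfolding exact_region_def by auto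
  define E where "E u v = a * C u v + b * D u v" for u v
  have E: "copula E"
  proof -
    have "a * C u v + b * D u v \<le> 1" if "u \<in> {0..1}" "v \<in> {0..1}" for u v
      using convex_bound_le[of "C u v" 1 "D u v" a b] copula_bounds[OF C(1)] copula_bounds[OF D(1)] ab that by auto
    moreover have "0 \<le> a * C u v + b * D u v" if "u \<in> {0..1}" "v \<in> {0..1}" for u v
      using copula_bounds[OF C(1)] copula_bounds[OF D(1)] ab that by auto
    moreover have "E u\<^sub>2 v\<^sub>2 - E u\<^sub>2 v\<^sub>1 - E u\<^sub>1 v\<^sub>2 + E u\<^sub>1 v\<^sub>1 \<ge> 0"
      if "0 \<le> u\<^sub>1 \<and> u\<^sub>1 \<le> u\<^sub>2 \<and> u\<^sub>2 \<le> 1 \<and> 0 \<le> v\<^sub>1 \<and> v\<^sub>1 \<le> v\<^sub>2 \<and> v\<^sub>2 \<le> 1" for u\<^sub>1 u\<^sub>2 v\<^sub>1 v\<^sub>2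
    proof -
      have "C u\<^sub>2 v\<^sub>2 - C u\<^sub>2 v\<^sub>1 - C u\<^sub>1 v\<^sub>2 + C u\<^sub>1 v\<^sub>1 \<ge> 0" "D u\<^sub>2 v\<^sub>2 - D u\<^sub>2 v\<^sub>1 - D u\<^sub>1 v\<^sub>2 + D u\<^sub>1 v\<^sub>1 \<ge> 0"
        using C(1) D(1) that unfolding copula_def by blast+
      hence "0 \<le> a * (C u\<^sub>2 v\<^sub>2 - C u\<^sub>2 v\<^sub>1 - C u\<^sub>1 v\<^sub>2 + C u\<^sub>1 v\<^sub>1) + b * (D u\<^sub>2 v\<^sub>2 - D u\<^sub>2 v\<^sub>1 - D u\<^sub>1 v\<^sub>2 + D u\<^sub>1 v\<^sub>1)"
        using ab by auto
      thus ?thesis by (simp add: E_def algebra_simps)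
    qed
    moreover have "a * u + b * u = u" for u using ab by (simp add: distrib_right[symmetric])
    ultimately show ?thesis using C(1) D(1) unfolding copula_def by (simp add: E_def)
  qed
  have d: "set_integrable lborel {0..1} (\<lambda>u. F u u)" if "copula F" for F
    by (rule borel_integrable_atLeastAtMost', rule copula_continuous_comp[OF that])
      (auto intro: continuous_intros)
  have b': "b = 1 - a" using ab(3) by simp
  have "spearman_footrule E = a * spearman_footrule C + b * spearman_footrule D"
    unfolding spearman_footrule_def E_def
    using d[OF C(1)] d[OF D(1)] by (simp add: set_integral_add b' algebra_simps)
  moreover have "spearman_rho E = a * spearman_rho C + b * spearman_rho D"
    unfolding spearman_rho_def E_def
    using copula_set_integrable[OF C(1)] copula_set_integrable[OF D(1)] by (simp add: set_integral_add b' algebra_simps)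
  ultimately have "a *\<^sub>R p + b *\<^sub>R q = (spearman_footrule E, spearman_rho E)"
    by (simp add: C D)
  thus "a *\<^sub>R p + b *\<^sub>R q \<in> region" using E unfolding exact_region_def by auto
qed

lemma lower_boundary_point:
  assumes "x \<in> {- 1 / 2..1}"
  shows "(x, rho_min x) \<in> region"
proof -
  define s where "s = sqrt ((1 + 2 * x) / 3)"
  have s: "0 \<le> s" "s \<le> 1" "s^2 = (1 + 2 * x) / 3" using assms by (auto simp: s_def)
  have "(3 * s^2 - 1) / 2 = x" using s(3) by (simp add: field_simps)
  moreover have "2 * s^3 - 1 = rho_min x" by (simp add: rho_min_def s_def)
  ultimately have "spearman_footrule (map_copula (end_flip s)) = x" "spearman_rho (map_copula (end_flip s)) = rho_min x"
    using end_flip_values(2,3)[OF s(1,2)] by simp_all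
  thus ?thesis using copula_map_copula[OF end_flip_values(1)[OF s(1,2)]] unfolding exact_region_def by force
qed

text \<open>The set \<open>J\<close> may contain either endpoint of the interval or not: closed strips cover the
  region, while half-open ones can be stacked without overlap.\<close>

lemma area_between_graphs:
  fixes f g :: "real \<Rightarrow> real"
  assumes ab: "a \<le> b" and J: "J \<in> sets borel" "{a<..<b} \<subseteq> J" "J \<subseteq> {a..b}"
    and c: "continuous_on {a..b} f" "continuous_on {a..b} g"
    and le: "\<And>x. x \<in> {a..b} \<Longrightarrow> f x \<le> g x"
  defines "A \<equiv> {(x, y). x \<in> J \<and> f x \<le> y \<and> y \<le> g x}"
  shows "A \<in> lmeasurable" "measure lebesgue A = integral {a..b} (\<lambda>x. g x - f x)"
proof -
  define f' g' where "f' x = (if x \<in> {a..b} then f x else 0)" and "g' x = (if x \<in> {a..b} then g x else 0)" for x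
  have [measurable]: "f' \<in> borel_measurable borel" "g' \<in> borel_measurable borel"
    unfolding f'_def g'_def by (intro borel_measurable_continuous_on_if c continuous_on_const; simp)+
  have [measurable]: "J \<in> sets borel" by fact
  have "{q \<in> space (borel \<Otimes>\<^sub>M borel). fst q \<in> J \<and> f' (fst q) \<le> snd q \<and> snd q \<le> g' (fst q)} \<in> sets (borel \<Otimes>\<^sub>M borel)"
    by measurable
  also have "{q \<in> space (borel \<Otimes>\<^sub>M borel). fst q \<in> J \<and> f' (fst q) \<le> snd q \<and> snd q \<le> g' (fst q)} = A"
    using J(3) by (auto simp: space_pair_measure A_def f'_def g'_def)
  finally have Ab: "A \<in> sets borel" by (simp only: borel_prod)
  hence Am: "A \<in> sets (lborel \<Otimes>\<^sub>M lborel)" by (simp only: lborel_prod sets_lborel)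
  have "emeasure lebesgue A = emeasure (lborel \<Otimes>\<^sub>M lborel) A"
    using Ab by (simp add: lborel_prod)
  also have "\<dots> = (\<integral>\<^sup>+x. emeasure lborel (Pair x -` A) \<partial>lborel)"
    by (rule lborel.emeasure_pair_measure_alt[OF Am])
  also have "\<dots> = (\<integral>\<^sup>+x. ennreal (g x - f x) * indicator {a..b} x \<partial>lborel)"
  proof (rule nn_integral_cong_AE)
    have "AE x in lborel. x \<noteq> a" "AE x in lborel. x \<noteq> b" by (rule AE_lborel_singleton)+
    thus "AE x in lborel. emeasure lborel (Pair x -` A) = ennreal (g x - f x) * indicator {a..b} x"
    proof eventually_elim
      fix x assume ne: "x \<noteq> a" "x \<noteq> b"
      show "emeasure lborel (Pair x -` A) = ennreal (g x - f x) * indicator {a..b} x"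
      proof (cases "x \<in> {a..b}")
        case True
        hence "x \<in> J" using ne J by auto
        hence "Pair x -` A = {f x..g x}" by (auto simp: A_def)
        thus ?thesis using le[OF True] True by simp
      next
        case False
        hence "Pair x -` A = {}" using J by (auto simp: A_def)
        thus ?thesis using False by simp
      qed
    qed
  qed
  also have "\<dots> = ennreal (integral {a..b} (\<lambda>x. g x - f x))"
    by (rule nn_integral_continuous_interval) (use c le in \<open>auto intro!: continuous_intros\<close>)
  finally have e: "emeasure lebesgue A = ennreal (integral {a..b} (\<lambda>x. g x - f x))" .
  have i0: "0 \<le> integral {a..b} (\<lambda>x. g x - f x)"
    by (rule integral_nonneg) (use c le in \<open>auto intro!: integrable_continuous_interval continuous_intros\<close>)
  show "A \<in> lmeasurable" using Ab e by (intro fmeasurableI) auto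
  show "measure lebesgue A = integral {a..b} (\<lambda>x. g x - f x)"
    using e i0 by (simp add: measure_def)
qed

text \<open>An antiderivative of the height \<open>rho_max - rho_min\<close>.\<close>

definition height_integral :: "real \<Rightarrow> real" where
  "height_integral x = 2 * x + 2 / 9 * (1 - x)^3 - 6 / 5 * sqrt ((1 + 2 * x) / 3) ^ 5"

lemma continuous_rho_min: "continuous_on S rho_min"
  unfolding rho_min_def by (intro continuous_intros) auto

lemma continuous_rho_max: "continuous_on S rho_max"
  unfolding rho_max_def by (intro continuous_intros)

lemma sqrt_power5_derivative:
  fixes p q x :: real
  assumes "0 < p + q * x"
  shows "((\<lambda>x. sqrt (p + q * x) ^ 5) has_real_derivative (5 / 2 * q * sqrt (p + q * x) ^ 3)) (at x)"
proof -
  define r where "r = sqrt (p + q * x)"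
  have r: "r > 0" using assms by (simp add: r_def)
  have "((\<lambda>x. sqrt (p + q * x)) has_real_derivative (inverse r / 2 * q)) (at x)"
    unfolding r_def by (rule DERIV_chain2[where f = sqrt and g = "\<lambda>x. p + q * x" and x = x, OF DERIV_real_sqrt[OF assms]]) (auto intro!: derivative_eq_intros)
  from DERIV_power[OF this, of 5]
  have "((\<lambda>x. sqrt (p + q * x) ^ 5) has_real_derivative (5 * (inverse r / 2 * q * r ^ 4))) (at x)"
    by (simp add: r_def)
  also have "5 * (inverse r / 2 * q * r ^ 4) = 5 / 2 * q * r ^ 3"
    using r by (simp add: field_simps eval_nat_numeral)
  finally show ?thesis by (simp add: r_def)
qed

lemma height_has_integral:
  assumes "- 1 / 2 \<le> a" "a \<le> b" "b \<le> 1"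
  shows "((\<lambda>x. rho_max x - rho_min x) has_integral (height_integral b - height_integral a)) {a..b}"
proof (rule fundamental_theorem_of_calculus_interior)
  show "continuous_on {a..b} height_integral" unfolding height_integral_def by (intro continuous_intros) auto
  fix x assume x: "x \<in> {a<..<b}"
  have e: "(1 + 2 * y) / 3 = 1/3 + 2/3 * y" for y :: real by simp
  have d: "((\<lambda>x. sqrt ((1 + 2 * x) / 3) ^ 5) has_real_derivative (5 / 2 * (2/3) * sqrt ((1 + 2 * x) / 3) ^ 3)) (at x)"
    unfolding e by (rule sqrt_power5_derivative) (use x assms in auto)
  have "(height_integral has_real_derivative
     (2 + 2 / 9 * (3 * (1 - x)^2 * (-1)) - 6 / 5 * (5 / 2 * (2/3) * sqrt ((1 + 2 * x) / 3) ^ 3))) (at x)"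
    unfolding height_integral_def by (rule derivative_eq_intros refl d | simp)+
  also have "2 + 2 / 9 * (3 * (1 - x)^2 * (-1)) - 6 / 5 * (5 / 2 * (2/3) * sqrt ((1 + 2 * x) / 3) ^ 3)
    = rho_max x - rho_min x" by (simp add: rho_max_def rho_min_def)
  finally show "(height_integral has_vector_derivative (rho_max x - rho_min x)) (at x)"
    by (simp add: has_real_derivative_iff_has_vector_derivative)
qed fact

text \<open>Measurability comes for free, since the region is convex and bounded.\<close>

lemma region_lmeasurable: "region \<in> lmeasurable"
  and region_area_le: "measure lebesgue region \<le> 21 / 20"
proof -
  let ?A = "{(x, y). x \<in> {-1/2..1} \<and> rho_min x \<le> y \<and> y \<le> rho_max x}"
  have sub: "region \<subseteq> ?A" using copula_rho_bounds by (auto simp: exact_region_def)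
  have le: "rho_min x \<le> rho_max x" if "x \<in> {-1/2..1}" for x
    using lower_boundary_point[OF that] sub by auto
  have A: "?A \<in> lmeasurable" "measure lebesgue ?A = integral {-1/2..1} (\<lambda>x. rho_max x - rho_min x)"
    by (rule area_between_graphs; use le continuous_rho_min continuous_rho_max in auto)+
  have "bounded ?A"
  proof (rule bounded_subset)
    have "- 1 \<le> rho_min x" "rho_max x \<le> 1" if "x \<in> {-1/2..1}" for x
      using that by (auto simp: rho_min_def rho_max_def)
    thus "?A \<subseteq> {-1/2..1} \<times> {-1..1}" by fastforce
    show "bounded ({-1/2..1::real} \<times> {-1..1::real})" by (intro bounded_Times) auto
  qed
  thus m: "region \<in> lmeasurable"
    using measurable_convex[OF convex_region] bounded_subset sub by blast
  have "measure lebesgue region \<le> measure lebesgue ?A"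
    by (rule measure_mono_fmeasurable[OF sub _ A(1)]) (use m in auto)
  also have "\<dots> = height_integral 1 - height_integral (-1/2)"
    unfolding A(2) by (rule integral_unique, rule height_has_integral) auto
  also have "\<dots> = 21 / 20" by (simp add: height_integral_def power3_eq_cube)
  finally show "measure lebesgue region \<le> 21 / 20" .
qed

section \<open>The area from below\<close>

definition area_left_of :: "real \<Rightarrow> real" where
  "area_left_of b = measure lebesgue (region \<inter> {p. fst p < b})"

lemma area_left_of_lmeasurable: "region \<inter> {p. fst p < b} \<in> lmeasurable"
proof -
  have "open {p :: real \<times> real. fst p < b}" by (intro open_Collect_less continuous_intros)
  hence "{p :: real \<times> real. fst p < b} \<in> sets lebesgue" by simp
  thus ?thesis using region_lmeasurable by (auto intro: fmeasurable_Int_fmeasurable)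
qed

text \<open>A curve of points of the region over \<open>[a, b]\<close> together with the lower boundary spans a strip
  inside the convex region. The area gained is that between the two boundary curves minus the loss
  \<open>d\<close> below the upper one.\<close>

lemma area_left_of_step:
  assumes ab: "- 1 / 2 \<le> a" "a \<le> b" "b \<le> 1"
    and g: "continuous_on {a..b} g" "\<And>x. x \<in> {a..b} \<Longrightarrow> (x, g x) \<in> region"
    and d: "((\<lambda>x. rho_max x - g x) has_integral d) {a..b}"
  shows "area_left_of a + (height_integral b - height_integral a) - d \<le> area_left_of b"
proof -
  let ?A = "{(x, y). x \<in> {a..<b} \<and> rho_min x \<le> y \<and> y \<le> g x}"
  have le: "rho_min x \<le> g x" if "x \<in> {a..b}" for x
    using g(2)[OF that] copula_rho_bounds(2) by (auto simp: exact_region_def)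
  have A: "?A \<in> lmeasurable" "measure lebesgue ?A = integral {a..b} (\<lambda>x. g x - rho_min x)"
    by (rule area_between_graphs; use le continuous_rho_min g ab in auto)+
  have "((\<lambda>x. (rho_max x - rho_min x) - (rho_max x - g x)) has_integral
      (height_integral b - height_integral a) - d) {a..b}"
    by (intro has_integral_diff height_has_integral d ab)
  hence mA: "measure lebesgue ?A = (height_integral b - height_integral a) - d"
    unfolding A(2) by (simp add: integral_unique)
  have sub: "?A \<subseteq> region"
  proof safe
    fix x y assume x: "x \<in> {a..<b}" and y: "rho_min x \<le> y" "y \<le> g x"
    have "(x, rho_min x) \<in> region" "(x, g x) \<in> region"
      using lower_boundary_point[of x] g(2)[of x] x ab by auto
    hence "closed_segment (x, rho_min x) (x, g x) \<subseteq> region"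
      using convex_region by (simp add: convex_contains_segment)
    moreover have "(x, y) \<in> closed_segment (x, rho_min x) (x, g x)"
    proof -
      have "y \<in> closed_segment (rho_min x) (g x)" using y by (simp add: closed_segment_eq_real_ivl)
      then obtain u where "0 \<le> u" "u \<le> 1" "y = (1 - u) * rho_min x + u * g x"
        by (auto simp: closed_segment_def)
      thus ?thesis by (auto simp: closed_segment_def algebra_simps intro!: exI[of _ u])
    qed
    ultimately show "(x, y) \<in> region" by blast
  qed
  have "?A - (region \<inter> {p. fst p < a}) = ?A" by auto
  hence "area_left_of a + measure lebesgue ?A = measure lebesgue ((region \<inter> {p. fst p < a}) \<union> ?A)"
    unfolding area_left_of_def
    using measure_Un2[OF area_left_of_lmeasurable[of a] A(1)] by simp
  also have "\<dots> \<le> area_left_of b" unfolding area_left_of_def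
    by (rule measure_mono_fmeasurable)
      (use A(1) area_left_of_lmeasurable ab sub in \<open>auto\<close>)
  finally show ?thesis using mA by simp
qed

text \<open>The upper curve is a parabola with leading coefficient \<open>-2/3\<close>, so it exceeds its chord over
  \<open>[a, b]\<close> by \<open>2/3 (x - a)(b - x)\<close>, which integrates to \<open>(b - a)\<^sup>3/9\<close>.\<close>

lemma area_chord_step:
  assumes ab: "- 1 / 2 \<le> a" "a < b" "b \<le> 1"
    and "(a, rho_max a) \<in> region" "(b, rho_max b) \<in> region"
  shows "area_left_of a + (height_integral b - height_integral a) - (b - a)^3 / 9 \<le> area_left_of b"
proof (rule area_left_of_step)
  \<comment> \<open>The chord of \<open>rho_max\<close> between \<open>a\<close> and \<open>b\<close>.\<close>
  define g where "g x = rho_max x - 2/3 * ((x - a) * (b - x))" for x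
  show "continuous_on {a..b} g" unfolding g_def by (intro continuous_intros continuous_rho_max)
  show "(x, g x) \<in> region" if x: "x \<in> {a..b}" for x
  proof -
    define u where "u = (b - x) / (b - a)"
    define v where "v = (x - a) / (b - a)"
    have uv: "0 \<le> u" "0 \<le> v" "u + v = 1" "u * a + v * b = x"
      using x ab by (auto simp: u_def v_def divide_simps) (simp_all add: algebra_simps)
    have u: "u = 1 - v" using uv by simp
    have x': "x = (1 - v) * a + v * b" using uv u by simp
    have "u * rho_max a + v * rho_max b = g x"
      unfolding g_def rho_max_def x' u by (simp add: power2_eq_square field_simps)
    hence "u *\<^sub>R (a, rho_max a) + v *\<^sub>R (b, rho_max b) = (x, g x)" using uv by simp
    thus ?thesis using convexD[OF convex_region assms(4,5) uv(1-3)] by simp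
  qed
  let ?P = "\<lambda>x. 2/3 * (- (x^3)/3 + (a + b) * x^2 / 2 - a * b * x)"
  have "((\<lambda>x. rho_max x - g x) has_integral (?P b - ?P a)) {a..b}"
  proof (rule fundamental_theorem_of_calculus)
    fix x
    have "(?P has_real_derivative rho_max x - g x) (at x within {a..b})"
      unfolding g_def by (auto intro!: derivative_eq_intros simp: field_simps power2_eq_square)
    thus "(?P has_vector_derivative rho_max x - g x) (at x within {a..b})"
      by (simp add: has_real_derivative_iff_has_vector_derivative)
  qed (use ab in simp)
  thus "((\<lambda>x. rho_max x - g x) has_integral (b - a)^3 / 9) {a..b}"
    by (rule has_integral_eq_rhs) (simp add: field_simps power2_eq_square power3_eq_cube)
qed (use ab in auto)

text \<open>Solving \<open>x = 12 t\<^sup>2 - 1/2\<close> for \<open>t\<close> turns the points of \<open>two_distance_swap\<close> into the graph of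
  a function of \<open>x\<close>.\<close>

lemma area_first_step: "height_integral (1/4) + 1/4 - 3/160 \<le> area_left_of (1/4)"
proof -
  define t where "t x = sqrt ((1 + 2 * x) / 24)" for x :: real
  define g where "g x = 1/2 + 2 * x - 24 * t x ^ 3" for x
  have ct: "continuous_on S t" for S unfolding t_def by (intro continuous_intros) auto
  have "area_left_of (-1/2) + (height_integral (1/4) - height_integral (-1/2)) - 3/160 \<le> area_left_of (1/4)"
  proof (rule area_left_of_step)
    show "continuous_on {-1/2..1/4} g" unfolding g_def by (intro continuous_intros ct)
    show "(x, g x) \<in> region" if x: "x \<in> {-1/2..1/4}" for x
    proof -
      have t: "0 \<le> t x" "(t x)^2 = (1 + 2 * x) / 24" using x by (auto simp: t_def)
      have "(t x)^2 \<le> (1/4)^2" using t x by (simp add: power2_eq_square)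
      hence "t x \<le> 1/4" by (rule power2_le_imp_le) simp
      hence "(12 * (t x)^2 - 1/2, 24 * (t x)^2 - 24 * (t x)^3 - 1/2) \<in> region"
        by (rule two_distance_swap_point[OF t(1)])
      moreover have "12 * (t x)^2 - 1/2 = x" "24 * (t x)^2 - 24 * (t x)^3 - 1/2 = g x"
        unfolding g_def t(2) by (simp_all add: field_simps)
      ultimately show ?thesis by simp
    qed
    define P where "P x = x + 2/9 * (1 - x)^3 - x / 2 - x^2 + 576/5 * (t x)^5" for x
    have "((\<lambda>x. rho_max x - g x) has_integral (P (1/4) - P (-1/2))) {-1/2..1/4}"
    proof (rule fundamental_theorem_of_calculus_interior)
      show "continuous_on {-1/2..1/4} P" unfolding P_def by (intro continuous_intros ct) auto
      fix x :: real assume x: "x \<in> {-1/2<..<1/4}"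
      have e: "(1 + 2 * y) / 24 = 1/24 + 1/12 * y" for y :: real by simp
      have d: "((\<lambda>x. t x ^ 5) has_real_derivative (5 / 2 * (1/12) * t x ^ 3)) (at x)"
        unfolding t_def e by (rule sqrt_power5_derivative) (use x in auto)
      have "(P has_real_derivative
          (1 + 2/9 * (3 * (1 - x)^2 * (-1)) - 1/2 - 2 * x + 576/5 * (5 / 2 * (1/12) * t x ^ 3))) (at x)"
        unfolding P_def by (rule derivative_eq_intros refl d | simp)+
      also have "1 + 2/9 * (3 * (1 - x)^2 * (-1)) - 1/2 - 2 * x + 576/5 * (5 / 2 * (1/12) * t x ^ 3)
        = rho_max x - g x" by (simp add: rho_max_def g_def)
      finally show "(P has_vector_derivative rho_max x - g x) (at x)"
        by (simp add: has_real_derivative_iff_has_vector_derivative)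
    qed simp
    moreover have "t (1/4) = 1/4" unfolding t_def by (rule real_sqrt_unique) (auto simp: power2_eq_square)
    moreover have "t (-1/2) = 0" unfolding t_def by simp
    ultimately show "((\<lambda>x. rho_max x - g x) has_integral 3/160) {-1/2..1/4}"
      unfolding P_def by (simp add: power2_eq_square power3_eq_cube eval_nat_numeral)
  qed auto
  moreover have "height_integral (-1/2) = -1/4" by (simp add: height_integral_def power3_eq_cube)
  moreover have "0 \<le> area_left_of (-1/2)" by (simp add: area_left_of_def)
  ultimately show ?thesis by simp
qed

text \<open>The footrule of the \<open>n\<close>-th block swap: \<open>-1/2\<close> and \<open>1/4\<close> for \<open>n = 1\<close> and \<open>n = 2\<close>, increasing
  to 1.\<close>

definition touching_footrule :: "nat \<Rightarrow> real" where "touching_footrule n = 1 - 3 / (2 * real n)"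

lemma touching_point: "0 < n \<Longrightarrow> (touching_footrule n, rho_max (touching_footrule n)) \<in> region"
  using block_swap_point[of n] by (simp add: touching_footrule_def rho_max_def power_divide power_mult_distrib)

lemma area_left_of_touching:
  "height_integral (touching_footrule (k + 2)) + 1/4 - 3/160 - 3/8 * (\<Sum>n<k. 1 / (real (n + 2) * real (n + 3))^3)
     \<le> area_left_of (touching_footrule (k + 2))"
proof (induction k)
  case 0
  show ?case using area_first_step by (simp add: touching_footrule_def)
next
  case (Suc k)
  have diff: "touching_footrule (k + 3) - touching_footrule (k + 2) = 3/2 * (1 / (real (k + 2) * real (k + 3)))"
    by (simp add: touching_footrule_def divide_simps) (simp add: algebra_simps)
  have "area_left_of (touching_footrule (k + 2)) + (height_integral (touching_footrule (k + 3)) - height_integral (touching_footrule (k + 2)))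
      - (touching_footrule (k + 3) - touching_footrule (k + 2))^3 / 9 \<le> area_left_of (touching_footrule (k + 3))"
  proof (rule area_chord_step)
    show "- 1 / 2 \<le> touching_footrule (k + 2)" by (simp add: touching_footrule_def divide_simps)
    have "0 < touching_footrule (k + 3) - touching_footrule (k + 2)" unfolding diff by simp
    thus "touching_footrule (k + 2) < touching_footrule (k + 3)" by simp
    show "touching_footrule (k + 3) \<le> 1" by (simp add: touching_footrule_def)
  qed (auto intro!: touching_point)
  moreover have "(touching_footrule (k + 3) - touching_footrule (k + 2))^3 / 9 = 3/8 * (1 / (real (k + 2) * real (k + 3))^3)"
    unfolding diff by (simp add: power_divide power_mult_distrib)
  moreover have "Suc k + 2 = k + 3" by simp
  ultimately show ?case using Suc.IH by (simp only: sum.lessThan_Suc distrib_left)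
qed

text \<open>With \<open>x = 1/(n+1)\<close> and \<open>y = 1/(n+2)\<close> one has \<open>x - y = xy\<close>, hence
  \<open>(xy)\<^sup>3 = (x\<^sup>3 - y\<^sup>3) - 3(x\<^sup>2 + y\<^sup>2) + 6(x - y)\<close>: two telescoping series and two copies of the
  series of inverse squares.\<close>

lemma sums_reciprocal_consecutive_cubes:
  "(\<lambda>n. 1 / (real (n + 1) * real (n + 2))^3) sums (10 - pi\<^sup>2)"
proof -
  have z: "(\<lambda>n. 1 / real (n + 1)^2) sums (pi\<^sup>2 / 6)" using inverse_squares_sums by (simp add: add.commute)
  have z2: "(\<lambda>n. 1 / real (n + 2)^2) sums (pi\<^sup>2 / 6 - 1)"
    using sums_Suc_iff[of "\<lambda>n. 1 / real (n + 1)^2" "pi\<^sup>2 / 6 - 1"] z by simp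
  have tele: "(\<lambda>n. 1 / real (n + 1)^m - 1 / real (n + 2)^m) sums 1" if "0 < m" for m
  proof -
    have "(\<lambda>n. 1 / real (Suc n)) \<longlonglongrightarrow> 0" by (rule LIMSEQ_Suc[OF lim_1_over_n])
    hence "(\<lambda>n. (1 / real (Suc n))^m) \<longlonglongrightarrow> 0^m" by (rule tendsto_power)
    hence "(\<lambda>n. 1 / real (n + 1)^m) \<longlonglongrightarrow> 0" using that by (simp add: power_divide zero_power)
    from telescope_sums'[OF this] show ?thesis by simp
  qed
  have "(\<lambda>n. (1 / real (n + 1)^3 - 1 / real (n + 2)^3) - 3 * (1 / real (n + 1)^2 + 1 / real (n + 2)^2)
      + 6 * (1 / real (n + 1)^1 - 1 / real (n + 2)^1)) sums (1 - 3 * (pi\<^sup>2 / 6 + (pi\<^sup>2 / 6 - 1)) + 6 * 1)"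
    by (intro sums_add sums_diff sums_mult z z2 tele) auto
  also have "1 - 3 * (pi\<^sup>2 / 6 + (pi\<^sup>2 / 6 - 1)) + 6 * 1 = 10 - pi\<^sup>2" by simp
  also have "(\<lambda>n. (1 / real (n + 1)^3 - 1 / real (n + 2)^3) - 3 * (1 / real (n + 1)^2 + 1 / real (n + 2)^2)
      + 6 * (1 / real (n + 1)^1 - 1 / real (n + 2)^1)) = (\<lambda>n. 1 / (real (n + 1) * real (n + 2))^3)"
  proof
    fix n
    define x y where "x = 1 / real (n + 1)" and "y = 1 / real (n + 2)"
    have xy: "x - y = x * y" by (simp add: x_def y_def divide_simps)
    have "x^3 - y^3 = (x - y) * ((x - y)^2 + 3 * (x * y))" by (simp add: power2_eq_square power3_eq_cube algebra_simps)
    hence 1: "x^3 - y^3 = (x * y)^3 + 3 * (x * y)^2"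
      unfolding xy by (simp add: power2_eq_square power3_eq_cube algebra_simps)
    have "x^2 + y^2 = (x - y)^2 + 2 * (x * y)" by (simp add: power2_eq_square algebra_simps)
    hence 2: "x^2 + y^2 = (x * y)^2 + 2 * (x * y)" unfolding xy .
    have "(x^3 - y^3) - 3 * (x^2 + y^2) + 6 * (x^1 - y^1) = (x * y)^3"
      unfolding 1 2 using xy by simp
    thus "(1 / real (n + 1)^3 - 1 / real (n + 2)^3) - 3 * (1 / real (n + 1)^2 + 1 / real (n + 2)^2)
      + 6 * (1 / real (n + 1)^1 - 1 / real (n + 2)^1) = 1 / (real (n + 1) * real (n + 2))^3"
      by (simp only: x_def y_def power_one_over times_divide_times_eq mult_1)
  qed
  finally show ?thesis .
qed

text \<open>Adding up the strips over \<open>[-1/2, 1 - 3/(2n)]\<close> and letting \<open>n\<close> tend to infinity.\<close>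

lemma region_area_ge: "3 * pi\<^sup>2 / 8 - 171 / 64 \<le> measure lebesgue region"
proof -
  let ?S = "\<lambda>k. \<Sum>n<k. 1 / (real (n + 2) * real (n + 3))^3"
  have "(\<lambda>n. 1 / (real (n + 2) * real (n + 3))^3) sums (10 - pi\<^sup>2 - 1/8)"
    using sums_Suc_iff[of "\<lambda>n. 1 / (real (n + 1) * real (n + 2))^3" "10 - pi\<^sup>2 - 1/8"]
      sums_reciprocal_consecutive_cubes by (simp add: numeral_3_eq_3)
  hence S: "?S \<longlonglongrightarrow> 10 - pi\<^sup>2 - 1/8" by (simp add: sums_def)
  have t: "(\<lambda>k. touching_footrule (k + 2)) \<longlonglongrightarrow> 1"
  proof -
    have "(\<lambda>k. 1 - 3/2 * (1 / real (k + 2))) \<longlonglongrightarrow> 1 - 3/2 * 0"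
      by (intro tendsto_intros LIMSEQ_ignore_initial_segment[OF lim_1_over_n])
    thus ?thesis by (simp add: touching_footrule_def)
  qed
  have "isCont height_integral 1" unfolding height_integral_def by (intro continuous_intros) auto
  hence "(\<lambda>k. height_integral (touching_footrule (k + 2))) \<longlonglongrightarrow> height_integral 1" using t by (rule isCont_tendsto_compose)
  hence "(\<lambda>k. height_integral (touching_footrule (k + 2)) + 1/4 - 3/160 - 3/8 * ?S k)
     \<longlonglongrightarrow> height_integral 1 + 1/4 - 3/160 - 3/8 * (10 - pi\<^sup>2 - 1/8)"
    by (intro tendsto_intros S)
  moreover have "height_integral (touching_footrule (k + 2)) + 1/4 - 3/160 - 3/8 * ?S k \<le> measure lebesgue region" for k
  proof -
    have "area_left_of (touching_footrule (k + 2)) \<le> measure lebesgue region" unfolding area_left_of_def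
      by (rule measure_mono_fmeasurable) (use region_lmeasurable area_left_of_lmeasurable in auto)
    thus ?thesis using area_left_of_touching[of k] by linarith
  qed
  ultimately have "height_integral 1 + 1/4 - 3/160 - 3/8 * (10 - pi\<^sup>2 - 1/8) \<le> measure lebesgue region"
    by (intro LIMSEQ_le_const2) auto
  thus ?thesis by (simp add: height_integral_def algebra_simps)
qed

theorem proposition16:
  "13 / 20 \<le> ksm spearman_footrule spearman_rho \<and>
   ksm spearman_footrule spearman_rho \<le> 121 / 64 - pi\<^sup>2 / 8"
proof -
  have "ksm spearman_footrule spearman_rho = 1 - measure lebesgue region / 3"
    unfolding ksm_def frechet_lower_values by simp
  thus ?thesis using region_area_le region_area_ge by simp
qed

end
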